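(* There is an absolute constant $C>0$ such that for every integer $n\ge1$ and every $\sigma\in[0,1)$, with $N=2^n$, the discrepancy function $D_N$ of the digit-scrambled van der Corput set $\mathcal V_{n,\sigma}$ satisfies \[ \|D_N\|_{\mathrm{BMO}_{1,2}}\le C(\log N)^{1/2}. \]
   Context: For an $N$-point set $\mathcal A\subset[0,1]^2$, $D_N(\vec x)=\sharp\big(\mathcal A\cap[0,x_1)\times[0,x_2)\big)-Nx_1x_2$. With $d_i(x)=\lfloor 2^ix\rfloor\bmod 2$ for $x\in[0,1)$: $x\oplus\sigma$ is defined by $d_i(x\oplus\sigma)=d_i(x)+d_i(\sigma)\bmod2$ for $1\le i\le n$ (only the first $n$ digits of $\sigma$ are used), and $\mathrm{rev}_n(x)$ by $d_i(\mathrm{rev}_nx)=d_{n+1-i}(x)$ for $1\le i\le n$, $0$ otherwise. $\mathcal V_{n,\sigma}=\{(\tau/2^n,\mathrm{rev}_n(\tau/2^n\oplus\sigma))+(2^{-n-1},2^{-n-1}):\tau=0,\dots,2^n-1\}$. Dyadic intervals are $[j2^{-k},(j+1)2^{-k})\subset[0,1)$; $h_I=-\mathbf 1_{I_{\mathrm{left}}}+\mathbf 1_{I_{\mathrm{right}}}$; for a dyadic rectangle $R=R_1\times R_2$, $h_R(x_1,x_2)=h_{R_1}(x_1)h_{R_2}(x_2)$. $\|f\|_{\mathrm{BMO}_{1,2}}=\sup_U\big[|U|^{-1}\sum_{R\text{ dyadic},R\subset U}\langle f,h_R\rangle^2/|R|\big]^{1/2}$, supremum over measurable $U\subset[0,1]^2$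 of positive measure, $\langle\cdot,\cdot\rangle$ the $L^2([0,1]^2)$ inner product. *)

theory Defs
  imports "HOL-Analysis.Analysis"
begin

section \<open>Binary digits, digital shift and digit reversal\<close>

definition bin_digit :: "nat \<Rightarrow> real \<Rightarrow> int" where
  "bin_digit i x = \<lfloor>2 ^ i * x\<rfloor> mod 2"

text \<open>The digits of \<open>x\<close> after the \<open>n\<close>-th one are kept; they are the summand
  \<open>frac (2 ^ n * x) / 2 ^ n\<close>. See \<open>bin_digit_digital_shift\<close> below.\<close>

definition digital_shift :: "nat \<Rightarrow> real \<Rightarrow> real \<Rightarrow> real" where
  "digital_shift n \<sigma> x =
     (\<Sum>i=1..n. of_int ((bin_digit i x + bin_digit i \<sigma>) mod 2) / 2 ^ i) + frac (2 ^ n * x) / 2 ^ n"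

definition digit_rev :: "nat \<Rightarrow> real \<Rightarrow> real" where
  "digit_rev n x = (\<Sum>i=1..n. of_int (bin_digit (n + 1 - i) x) / 2 ^ i)"

lemma bin_expansion_range:
  fixes b :: "nat \<Rightarrow> int" and t :: real
  assumes "\<And>i. b i \<in> {0, 1}" "0 \<le> t" "t < 1"
  shows "(\<Sum>i=1..n. of_int (b i) / 2 ^ i) + t / 2 ^ n \<in> {0..<1::real}"
  using assms(2,3)
proof (induction n arbitrary: t)
  case (Suc n)
  have b: "b (Suc n) = 0 \<or> b (Suc n) = 1" using assms(1)[of "Suc n"] by simp
  have "(\<Sum>i=1..n. of_int (b i) / 2 ^ i) + ((of_int (b (Suc n)) + t) / 2) / 2 ^ n \<in> {0..<1::real}"
    using Suc.prems b by (intro Suc.IH) auto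
  then show ?case by (simp add: field_simps)
qed simp

lemma bin_expansion_int:
  fixes b :: "nat \<Rightarrow> int"
  shows "\<exists>k::int. 2 ^ n * (\<Sum>i=1..n. of_int (b i) / 2 ^ i :: real) = of_int k"
proof (induction n)
  case (Suc n)
  then obtain k :: int where "2 ^ n * (\<Sum>i=1..n. of_int (b i) / 2 ^ i :: real) = of_int k" by blast
  then have "2 ^ Suc n * (\<Sum>i=1..Suc n. of_int (b i) / 2 ^ i :: real) = of_int (2 * k + b (Suc n))"
    by (simp add: algebra_simps)
  then show ?case by blast
qed (auto intro: exI[of _ 0])

lemma bin_digit_expansion_high:
  fixes b :: "nat \<Rightarrow> int" and t :: real
  assumes "n < i"
  shows "bin_digit i ((\<Sum>i=1..n. of_int (b i) / 2 ^ i) + t / 2 ^ n) = bin_digit (i - n) t"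
proof -
  obtain k :: int where k: "2 ^ n * (\<Sum>i=1..n. of_int (b i) / 2 ^ i :: real) = of_int k"
    using bin_expansion_int by blast
  have i: "(2::real) ^ i = 2 ^ (i - n) * 2 ^ n"
    using assms by (simp flip: power_add)
  have "2 ^ i * ((\<Sum>i=1..n. of_int (b i) / 2 ^ i) + t / 2 ^ n)
      = 2 ^ (i - n) * (2 ^ n * (\<Sum>i=1..n. of_int (b i) / 2 ^ i)) + 2 ^ (i - n) * t"
    unfolding i by (simp add: field_simps)
  also have "\<dots> = of_int (2 ^ (i - n) * k) + 2 ^ (i - n) * t"
    unfolding k by simp
  finally have "\<lfloor>2 ^ i * ((\<Sum>i=1..n. of_int (b i) / 2 ^ i) + t / 2 ^ n)\<rfloor>
      = 2 ^ (i - n) * k + \<lfloor>2 ^ (i - n) * t\<rfloor>" by (simp only: int_add_floor)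
  moreover have "(2::int) dvd 2 ^ (i - n) * k" using assms by simp
  ultimately show ?thesis by (metis bin_digit_def dvd_imp_mod_0 add_0 mod_add_left_eq)
qed

lemma bin_digit_expansion_low:
  fixes b :: "nat \<Rightarrow> int" and t :: real
  assumes "\<And>i. b i \<in> {0, 1}" "0 \<le> t" "t < 1" "1 \<le> i" "i \<le> n"
  shows "bin_digit i ((\<Sum>i=1..n. of_int (b i) / 2 ^ i) + t / 2 ^ n) = b i"
  using assms(2-)
proof (induction n arbitrary: t)
  case (Suc n)
  have b: "b (Suc n) = 0 \<or> b (Suc n) = 1" using assms(1)[of "Suc n"] by simp
  have eq: "(\<Sum>i=1..Suc n. of_int (b i) / 2 ^ i) + t / 2 ^ Suc n
    = (\<Sum>i=1..n. of_int (b i) / 2 ^ i) + ((of_int (b (Suc n)) + t) / 2) / 2 ^ n"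
    by (simp add: field_simps)
  show ?case
  proof (cases "i = Suc n")
    case True
    have "\<lfloor>of_int (b (Suc n)) + t\<rfloor> = b (Suc n)" using Suc.prems by (simp add: floor_eq_iff)
    then have "bin_digit 1 ((of_int (b (Suc n)) + t) / 2) = b (Suc n)"
      unfolding bin_digit_def power_one_right times_divide_eq_right
      using b by (metis mod_pos_pos_trivial nonzero_mult_div_cancel_left zero_neq_numeral
          zero_less_one_class.zero_le_one order_refl one_less_numeral_iff semiring_norm(76) zero_less_numeral)
    then show ?thesis
      unfolding eq True
      using bin_digit_expansion_high[of n "Suc n" b "(of_int (b (Suc n)) + t) / 2"] by simp
  next
    case False
    then show ?thesis unfolding eq using Suc.prems b by (intro Suc.IH) auto
  qed
qed simp

lemma bin_digit_01: "bin_digit i x \<in> {0, 1}"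
  by (auto simp: bin_digit_def)

lemma digital_shift_range: "digital_shift n \<sigma> x \<in> {0..<1}"
  unfolding digital_shift_def by (rule bin_expansion_range) (auto simp: frac_lt_1)

lemma bin_digit_digital_shift:
  "1 \<le> i \<Longrightarrow> i \<le> n \<Longrightarrow>
     bin_digit i (digital_shift n \<sigma> x) = (bin_digit i x + bin_digit i \<sigma>) mod 2"
  "n < i \<Longrightarrow> bin_digit i (digital_shift n \<sigma> x) = bin_digit i x"
proof -
  assume "1 \<le> i" "i \<le> n"
  then show "bin_digit i (digital_shift n \<sigma> x) = (bin_digit i x + bin_digit i \<sigma>) mod 2"
    unfolding digital_shift_def
    by (subst bin_digit_expansion_low) (auto simp: frac_lt_1)
next
  assume i: "n < i"
  have "bin_digit i (digital_shift n \<sigma> x) = bin_digit (i - n) (frac (2 ^ n * x))"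
    unfolding digital_shift_def by (rule bin_digit_expansion_high[OF i])
  also have "\<dots> = bin_digit i x"
  proof -
    have "2 ^ i * x = 2 ^ (i - n) * frac (2 ^ n * x) + of_int (2 ^ (i - n) * \<lfloor>2 ^ n * x\<rfloor>)"
      using i by (simp add: frac_def right_diff_distrib mult.assoc[symmetric] flip: power_add)
    then have "\<lfloor>2 ^ i * x\<rfloor> = \<lfloor>2 ^ (i - n) * frac (2 ^ n * x)\<rfloor> + 2 ^ (i - n) * \<lfloor>2 ^ n * x\<rfloor>"
      by (metis floor_add_int)
    moreover have "(2::int) dvd 2 ^ (i - n) * \<lfloor>2 ^ n * x\<rfloor>" using i by simp
    ultimately show ?thesis by (metis bin_digit_def dvd_imp_mod_0 add_0_right mod_add_right_eq)
  qed
  finally show "bin_digit i (digital_shift n \<sigma> x) = bin_digit i x" .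
qed

lemma digit_rev_range: "digit_rev n x \<in> {0..<1}"
  using bin_expansion_range[of "\<lambda>i. bin_digit (n + 1 - i) x" 0 n] bin_digit_01
  by (simp add: digit_rev_def)

lemma bin_digit_digit_rev:
  "1 \<le> i \<Longrightarrow> i \<le> n \<Longrightarrow> bin_digit i (digit_rev n x) = bin_digit (n + 1 - i) x"
  "n < i \<Longrightarrow> bin_digit i (digit_rev n x) = 0"
  using bin_digit_expansion_low[of "\<lambda>i. bin_digit (n + 1 - i) x" 0 i n] bin_digit_01
    bin_digit_expansion_high[of n i "\<lambda>i. bin_digit (n + 1 - i) x" 0]
  by (simp_all add: digit_rev_def) (simp add: bin_digit_def)


section \<open>The scrambled van der Corput set and the discrepancy function\<close>

definition vdc_set :: "nat \<Rightarrow> real \<Rightarrow> (real \<times> real) set" where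
  "vdc_set n \<sigma> =
     (\<lambda>\<tau>::nat. (real \<tau> / 2 ^ n, digit_rev n (digital_shift n \<sigma> (real \<tau> / 2 ^ n)))
              + (1 / 2 ^ (n + 1), 1 / 2 ^ (n + 1))) ` {0..2 ^ n - 1}"

lemma card_vdc_set: "card (vdc_set n \<sigma>) = 2 ^ n"
  unfolding vdc_set_def by (subst card_image) (auto simp: inj_on_def)

text \<open>The number \<open>N\<close> of points is \<open>card A\<close>.\<close>

definition discrepancy :: "(real \<times> real) set \<Rightarrow> real \<times> real \<Rightarrow> real" where
  "discrepancy A x =
     real (card (A \<inter> {0..<fst x} \<times> {0..<snd x})) - real (card A) * fst x * snd x"


section \<open>Dyadic rectangles, Haar functions and dyadic product BMO\<close>

text \<open>The dyadic interval \<open>[j / 2 ^ k, (j + 1) / 2 ^ k) \<subseteq> [0,1)\<close> is encoded by the pair \<open>(k, j)\<close>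
  with \<open>j < 2 ^ k\<close>; this encoding is one-to-one. A dyadic rectangle is encoded by a pair of such
  pairs.\<close>

type_synonym dyadic = "nat \<times> nat"

definition dyadics :: "dyadic set" where
  "dyadics = {(k, j). j < 2 ^ k}"

definition dyadic_ivl :: "dyadic \<Rightarrow> real set" where
  "dyadic_ivl I = (case I of (k, j) \<Rightarrow> {real j / 2 ^ k ..< (real j + 1) / 2 ^ k})"

definition left_half :: "dyadic \<Rightarrow> dyadic" where
  "left_half I = (case I of (k, j) \<Rightarrow> (Suc k, 2 * j))"

definition right_half :: "dyadic \<Rightarrow> dyadic" where
  "right_half I = (case I of (k, j) \<Rightarrow> (Suc k, 2 * j + 1))"

definition haar :: "dyadic \<Rightarrow> real \<Rightarrow> real" where
  "haar I x = - indicator (dyadic_ivl (left_half I)) x + indicator (dyadic_ivl (right_half I)) x"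

lemma inj_on_dyadic_ivl: "inj_on dyadic_ivl dyadics"
proof (rule inj_onI)
  fix I J assume eq: "dyadic_ivl I = dyadic_ivl J"
  obtain k j l m where [simp]: "I = (k, j)" "J = (l, m)" by fastforce
  have lt: "real j / 2 ^ k < (real j + 1) / 2 ^ k" "real m / 2 ^ l < (real m + 1) / 2 ^ l"
    by (simp_all add: divide_strict_right_mono)
  have left: "real j / 2 ^ k = real m / 2 ^ l"
    and right: "(real j + 1) / 2 ^ k = (real m + 1) / 2 ^ l"
    using eq lt Ico_eq_Ico[of "real j / 2 ^ k" "(real j + 1) / 2 ^ k" "real m / 2 ^ l"]
    by (auto simp: dyadic_ivl_def)
  then have "1 / 2 ^ k = (1::real) / 2 ^ l" by (simp add: add_divide_distrib)
  then have "k = l" by simp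
  with left show "I = J" by simp
qed

definition dyadic_rects :: "(dyadic \<times> dyadic) set" where
  "dyadic_rects = dyadics \<times> dyadics"

definition dyadic_rect :: "dyadic \<times> dyadic \<Rightarrow> (real \<times> real) set" where
  "dyadic_rect R = dyadic_ivl (fst R) \<times> dyadic_ivl (snd R)"

definition haar_rect :: "dyadic \<times> dyadic \<Rightarrow> real \<times> real \<Rightarrow> real" where
  "haar_rect R x = haar (fst R) (fst x) * haar (snd R) (snd x)"

abbreviation unit_square :: "(real \<times> real) set" where
  "unit_square \<equiv> {0..1} \<times> {0..1}"

definition inner_L2 :: "(real \<times> real \<Rightarrow> real) \<Rightarrow> (real \<times> real \<Rightarrow> real) \<Rightarrow> real" where
  "inner_L2 f g = (LINT x:unit_square|lebesgue. f x * g x)"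

definition ennsqrt :: "ennreal \<Rightarrow> ennreal" where
  "ennsqrt x = (if x = \<infinity> then \<infinity> else ennreal (sqrt (enn2real x)))"

text \<open>The norm takes values in \<open>[0, \<infinity>]\<close>, so neither the infinite sum nor the supremum
  needs a convergence hypothesis.\<close>

definition bmo_norm :: "(real \<times> real \<Rightarrow> real) \<Rightarrow> ennreal" where
  "bmo_norm f =
     (SUP U \<in> {U \<in> sets lebesgue. U \<subseteq> unit_square \<and> measure lebesgue U > 0}.
        ennsqrt ((\<Sum>\<^sub>\<infinity>R \<in> {R \<in> dyadic_rects. dyadic_rect R \<subseteq> U}.
                    ennreal ((inner_L2 f (haar_rect R))\<^sup>2 / measure lebesgue (dyadic_rect R)))
                 / emeasure lebesgue U))"

end

theory Submission
  imports Defs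
begin

text \<open>
  Put \<open>N = 2\<^sup>n\<close>. The Haar coefficient of \<open>D\<^sub>N\<close> at \<open>R\<close> is
  \<open>(\<Sum>p. tent\<^bsub>R\<^sub>1\<^esub>(p\<^sub>1) tent\<^bsub>R\<^sub>2\<^esub>(p\<^sub>2)) - N |R|\<^sup>2 / 16\<close>, where \<open>tent\<^bsub>I\<^esub>(t)\<close> is the integral of
  \<open>h\<^sub>I\<close> over \<open>(t,1]\<close>. For \<open>|R| \<ge> 1 / N\<close> the coefficient is at most \<open>1 / N\<close>:
  flipping the digit that exchanges the halves of \<open>R\<^sub>1\<close> hardly moves the second coordinate, and
  vice versa, and averaging over both flips cancels everything else. For \<open>|R| < 1 / N\<close>
  the rectangle holds at most one point, so the linear part is negligible and the tent part is at
  most \<open>|R| / 4\<close>. The first estimate decays geometrically in the distance of \<open>|R|\<close> from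
  \<open>1 / N\<close>, and there are about \<open>n\<close> shapes for each area. For the tent parts, fix the width of \<open>R\<close>:
  the rectangles through one point form a geometric series dominated by the tallest of them, and
  rectangles through different points are disjoint, so each of the \<open>n + 1\<close> widths contributes
  at most \<open>2 |U|\<close>.
\<close>

section \<open>Digits of the points\<close>

text \<open>Integer form of \<open>2 ^ n\<close> times the second coordinate before the half-cell
  shift. Bit \<open>i\<close> of an integer below \<open>2 ^ n\<close> is digit \<open>n - i\<close>
  of its quotient by \<open>2 ^ n\<close>; the mask \<open>s\<close>, which encodes \<sigma>, is
  indexed by the bits of the input.\<close>

definition scramble :: "nat \<Rightarrow> (nat \<Rightarrow> bool) \<Rightarrow> nat \<Rightarrow> nat" where
  "scramble n s \<tau> =
     horner_sum of_bool 2 (map (\<lambda>i. bit \<tau> (n - 1 - i) \<noteq> s (n - 1 - i)) [0..<n])"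

lemma bit_scramble:
  "bit (scramble n s \<tau>) i \<longleftrightarrow> i < n \<and> (bit \<tau> (n - 1 - i) \<noteq> s (n - 1 - i))"
  by (auto simp: scramble_def bit_horner_sum_bit_iff)

lemma scramble_less: "scramble n s \<tau> < 2 ^ n"
  by (metis bit_scramble bit_take_bit_iff bit_eqI take_bit_nat_less_exp)

text \<open>This is how the two coordinates interact: a low bit of the index is a high bit of its
  scramble, so a small move in one coordinate is a large move in the other.\<close>

lemma scramble_flip_bit:
  assumes "i < n"
  shows "scramble n s (flip_bit i \<tau>) = flip_bit (n - 1 - i) (scramble n s \<tau>)"
  by (rule bit_eqI) (use assms in \<open>auto simp: bit_scramble bit_simps\<close>)

lemma flip_bit_less:
  fixes \<tau> :: nat
  assumes "\<tau> < 2 ^ n" "i < n"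
  shows "flip_bit i \<tau> < 2 ^ n"
  using assms by (metis take_bit_flip_bit_eq take_bit_nat_eq_self_iff leD)

lemma flip_bit_flip_bit: "flip_bit i (flip_bit i (\<tau>::nat)) = \<tau>"
  by (rule bit_eqI) (auto simp: bit_simps)

lemma flip_bit_commute: "flip_bit i (flip_bit j (\<tau>::nat)) = flip_bit j (flip_bit i \<tau>)"
  by (rule bit_eqI) (auto simp: bit_simps)

lemma drop_bit_flip_bit:
  "i < k \<Longrightarrow> drop_bit k (flip_bit i (\<tau>::nat)) = drop_bit k \<tau>"
  by (rule bit_eqI) (auto simp: bit_simps)

lemma abs_diff_flip_bit: "\<bar>real (flip_bit i \<tau>) - real \<tau>\<bar> = 2 ^ i"
proof (cases "bit \<tau> i")
  case True
  have "unset_bit i \<tau> + 2 ^ i = \<tau>"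
  proof -
    have "set_bit i (unset_bit i \<tau>) = \<tau>"
      by (rule bit_eqI) (use True in \<open>auto simp: bit_simps\<close>)
    then show ?thesis by (simp add: set_bit_eq bit_simps)
  qed
  then have "real (unset_bit i \<tau> + 2 ^ i) = real \<tau>"
    by (rule arg_cong)
  then have "real (unset_bit i \<tau>) - real \<tau> = - (2 ^ i)"
    by simp
  with True show ?thesis by (simp add: flip_bit_eq_if)
next
  case False
  then show ?thesis by (simp add: flip_bit_eq_if set_bit_eq)
qed

text \<open>Centre of the \<tau>-th grid cell of side \<open>1 / 2 ^ n\<close>; the
  \<open>1 / 2\<close> is the summand \<open>1 / 2 ^ (n + 1)\<close> of
  \<open>vdc_set\<close>.\<close>

definition cell_mid :: "nat \<Rightarrow> nat \<Rightarrow> real" where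
  "cell_mid n \<tau> = (real \<tau> + 1 / 2) / 2 ^ n"

lemma mem_dyadic_ivl: "t \<in> dyadic_ivl (k, j) \<longleftrightarrow> \<lfloor>2 ^ k * t\<rfloor> = int j"
  by (simp add: dyadic_ivl_def floor_eq_iff pos_divide_le_eq pos_less_divide_eq mult.commute)

lemma floor_power2_coarsen:
  fixes t :: real
  assumes "k \<le> m"
  shows "\<lfloor>2 ^ k * t\<rfloor> = \<lfloor>2 ^ m * t\<rfloor> div 2 ^ (m - k)"
proof -
  have "(2::real) ^ m = 2 ^ k * 2 ^ (m - k)"
    using assms by (simp flip: power_add)
  then have "2 ^ k * t = (2 ^ m * t) / real_of_int (2 ^ (m - k))"
    by simp
  then show ?thesis using floor_divide_real_eq_div[of "2 ^ (m - k)" "2 ^ m * t"] by simp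
qed

lemma floor_cell_mid: "\<lfloor>2 ^ n * cell_mid n \<tau>\<rfloor> = int \<tau>"
  by (simp add: cell_mid_def floor_eq_iff)

text \<open>The half cell does not reach the first \<open>n\<close> binary digits, so membership at
  level \<open>k <= n\<close> is a condition on the bits of \<tau> from \<open>n - k\<close>
  on.\<close>

lemma cell_mid_mem_dyadic_ivl:
  assumes "k \<le> n"
  shows "cell_mid n \<tau> \<in> dyadic_ivl (k, j) \<longleftrightarrow> drop_bit (n - k) \<tau> = j"
proof -
  have "\<lfloor>2 ^ k * cell_mid n \<tau>\<rfloor> = int (drop_bit (n - k) \<tau>)"
    by (simp only: floor_power2_coarsen[OF assms] floor_cell_mid drop_bit_eq_div zdiv_int
        of_nat_power of_nat_numeral)
  then show ?thesis by (simp add: mem_dyadic_ivl)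
qed

lemma abs_diff_cell_mid_flip_bit:
  "\<bar>cell_mid n (flip_bit i \<tau>) - cell_mid n \<tau>\<bar> = 2 ^ i / 2 ^ n"
proof -
  have "cell_mid n (flip_bit i \<tau>) - cell_mid n \<tau> = (real (flip_bit i \<tau>) - real \<tau>) / 2 ^ n"
    by (simp only: cell_mid_def diff_divide_distrib add_divide_distrib)
  then show ?thesis by (simp only: abs_divide abs_diff_flip_bit) simp
qed

section \<open>The scrambled points and their distribution among dyadic rectangles\<close>

definition vdc_point :: "nat \<Rightarrow> (nat \<Rightarrow> bool) \<Rightarrow> nat \<Rightarrow> real \<times> real" where
  "vdc_point n s \<tau> = (cell_mid n \<tau>, cell_mid n (scramble n s \<tau>))"

lemma inj_vdc_point: "inj (vdc_point n s)"
  by (auto simp: inj_def vdc_point_def cell_mid_def)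

lemma bin_digit_dyadic_rational:
  assumes "m \<le> n"
  shows "bin_digit m (real \<tau> / 2 ^ n) = of_bool (bit \<tau> (n - m))"
proof -
  have "\<lfloor>2 ^ m * (real \<tau> / 2 ^ n)\<rfloor> = int (\<tau> div 2 ^ (n - m))"
    using floor_power2_coarsen[OF assms, of "real \<tau> / 2 ^ n"] by (simp add: zdiv_int)
  then show ?thesis
    by (simp only: bin_digit_def bit_iff_odd mod_2_eq_odd even_of_nat)
qed

text \<open>Passes from real digits to integer bits. The combinatorial estimates hold for every mask
  \<open>s\<close>; \<sigma> only selects one of them.\<close>

lemma vdc_set_eq:
  "vdc_set n \<sigma> = vdc_point n (\<lambda>i. bin_digit (n - i) \<sigma> = 1) ` {..<2 ^ n}"
proof -
  define s where "s = (\<lambda>i. bin_digit (n - i) \<sigma> = 1)"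
  have "digit_rev n (digital_shift n \<sigma> (real \<tau> / 2 ^ n)) = real (scramble n s \<tau>) / 2 ^ n" for \<tau>
  proof -
    \<comment> \<open>Digit \<open>m\<close> of \<open>\<tau> / 2 ^ n\<close> is bit
      \<open>n - m\<close> of \<tau>, which is bit \<open>i - 1\<close> for the reversed position
      \<open>m = n + 1 - i\<close>.\<close>
    have dig: "bin_digit (n + 1 - i) (digital_shift n \<sigma> (real \<tau> / 2 ^ n))
        = of_bool (bit \<tau> (i - 1) \<noteq> s (i - 1))" if "1 \<le> i" "i \<le> n" for i
    proof -
      have "n - (n + 1 - i) = i - 1" "n - (i - 1) = n + 1 - i" using that by auto
      then have "bin_digit (n + 1 - i) (digital_shift n \<sigma> (real \<tau> / 2 ^ n))
        = (of_bool (bit \<tau> (i - 1)) + bin_digit (n + 1 - i) \<sigma>) mod 2"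
        using that by (simp add: bin_digit_digital_shift(1) bin_digit_dyadic_rational)
      moreover have "bin_digit (n + 1 - i) \<sigma> = of_bool (s (i - 1))"
        using bin_digit_01[of "n + 1 - i" \<sigma>] \<open>n - (i - 1) = n + 1 - i\<close> by (auto simp: s_def)
      ultimately show ?thesis by auto
    qed
    have "real (scramble n s \<tau>)
        = (\<Sum>i<n. of_bool (bit \<tau> (n - 1 - i) \<noteq> s (n - 1 - i)) * 2 ^ i)"
      by (simp add: scramble_def horner_sum_eq_sum atLeast0LessThan)
    also have "\<dots> = (\<Sum>i=1..n. of_bool (bit \<tau> (i - 1) \<noteq> s (i - 1)) * 2 ^ (n - i))"
      by (rule sum.reindex_bij_witness[of _ "\<lambda>i. n - i" "\<lambda>i. n - i"]) auto
    also have "\<dots> / 2 ^ n = digit_rev n (digital_shift n \<sigma> (real \<tau> / 2 ^ n))"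
      unfolding digit_rev_def sum_divide_distrib
      by (rule sum.cong) (simp_all only: dig atLeastAtMost_iff, simp_all add: power_diff)
    finally show ?thesis by simp
  qed
  moreover have "{0..2 ^ n - 1} = {..<2 ^ n::nat}"
    by (auto simp: le_diff_conv2 Suc_le_eq)
  ultimately show ?thesis
    unfolding vdc_set_def s_def[symmetric]
    by (intro image_cong) (auto simp: vdc_point_def cell_mid_def field_simps)
qed

text \<open>The first side fixes the top \<open>k\<close> of the \<open>n\<close> bits of \<tau>.
  The second side, coarsened to level \<open>n - k\<close>, fixes the top \<open>n - k\<close> bits
  of the scramble, which are the low \<open>n - k\<close> bits of \<tau> up to the mask. Coarsening
  first matters because \<open>l\<close> may exceed \<open>n\<close>.\<close>

lemma vdc_point_unique:
  assumes "n \<le> k + l" "k \<le> n" "\<tau> < 2 ^ n" "\<tau>' < 2 ^ n"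
    and p: "vdc_point n s \<tau> \<in> dyadic_rect ((k, i), (l, j))"
    and p': "vdc_point n s \<tau>' \<in> dyadic_rect ((k, i), (l, j))"
  shows "\<tau> = \<tau>'"
proof -
  have x: "drop_bit (n - k) \<tau> = drop_bit (n - k) \<tau>'"
    using p p' assms by (simp add: vdc_point_def dyadic_rect_def cell_mid_mem_dyadic_ivl)
  have "\<lfloor>2 ^ l * cell_mid n (scramble n s \<tau>)\<rfloor> = \<lfloor>2 ^ l * cell_mid n (scramble n s \<tau>')\<rfloor>"
    using p p' by (simp add: vdc_point_def dyadic_rect_def mem_dyadic_ivl)
  then have "\<lfloor>2 ^ (n - k) * cell_mid n (scramble n s \<tau>)\<rfloor> = \<lfloor>2 ^ (n - k) * cell_mid n (scramble n s \<tau>')\<rfloor>"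
    using floor_power2_coarsen[of "n - k" l] assms(1) by simp
  then have "int (scramble n s \<tau>) div 2 ^ k = int (scramble n s \<tau>') div 2 ^ k"
    using floor_power2_coarsen[of "n - k" n] \<open>k \<le> n\<close> by (simp add: floor_cell_mid)
  then have "int (scramble n s \<tau> div 2 ^ k) = int (scramble n s \<tau>' div 2 ^ k)"
    by (simp add: zdiv_int)
  then have y: "drop_bit k (scramble n s \<tau>) = drop_bit k (scramble n s \<tau>')"
    by (simp add: drop_bit_eq_div)
  show ?thesis
  proof (rule bit_eqI)
    fix b
    consider "b \<ge> n" | "n - k \<le> b" "b < n" | "b < n - k" by linarith
    then show "bit \<tau> b \<longleftrightarrow> bit \<tau>' b"
    proof cases
      case 1
      then show ?thesis
        using assms(3,4) by (metis bit_take_bit_iff take_bit_nat_eq_self_iff leD)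
    next
      case 2
      then show ?thesis
        using arg_cong[OF x, of "\<lambda>z. bit z (b - (n - k))"] by (simp add: bit_drop_bit_eq)
    next
      case 3
      then show ?thesis
        using arg_cong[OF y, of "\<lambda>z. bit z (n - 1 - b - k)"]
        by (auto simp: bit_drop_bit_eq bit_scramble)
    qed
  qed
qed

text \<open>\<open>\<Phi>\<close> records the position of a point in the grid of shape
  \<open>(n - l, l)\<close>, whose \<open>2 ^ n\<close> rectangles hold at most one point each. By
  counting, each holds exactly one, and the given rectangle is a row of \<open>2 ^ m\<close> of
  them.\<close>

lemma card_vdc_point_rect:
  assumes kl: "k + l \<le> n" and i: "i < 2 ^ k" and j: "j < 2 ^ l"
  shows "card {\<tau>. \<tau> < 2 ^ n \<and> vdc_point n s \<tau> \<in> dyadic_rect ((k, i), (l, j))} = 2 ^ (n - k - l)"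
proof -
  define \<Phi> where "\<Phi> \<tau> = (drop_bit l \<tau>, drop_bit (n - l) (scramble n s \<tau>))" for \<tau>
  define m where "m = n - k - l"
  define S where "S = {\<tau>. \<tau> < 2 ^ n \<and> vdc_point n s \<tau> \<in> dyadic_rect ((k, i), (l, j))}"
  have ln: "l \<le> n" "k \<le> n" using kl by auto
  have "inj_on \<Phi> {..<2 ^ n}"
  proof (rule inj_onI)
    fix \<tau> \<tau>' assume \<tau>: "\<tau> \<in> {..<2 ^ n}" "\<tau>' \<in> {..<2 ^ n}" "\<Phi> \<tau> = \<Phi> \<tau>'"
    then show "\<tau> = \<tau>'"
      using ln by (intro vdc_point_unique[of n "n - l" l \<tau> \<tau>' s "drop_bit l \<tau>" "drop_bit (n - l) (scramble n s \<tau>)"])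
        (auto simp: vdc_point_def dyadic_rect_def cell_mid_mem_dyadic_ivl \<Phi>_def)
  qed
  moreover have "drop_bit b t < 2 ^ (n - b)" if "t < 2 ^ n" "b \<le> n" for b t :: nat
    using that less_mult_imp_div_less[of t "2 ^ (n - b)" "2 ^ b"]
    by (simp add: drop_bit_eq_div flip: power_add)
  from this[of _ l] this[OF scramble_less, of "n - l"]
  have "\<Phi> ` {..<2 ^ n} \<subseteq> {..<2 ^ (n - l)} \<times> {..<2 ^ l}"
    using ln by (auto simp: \<Phi>_def)
  moreover have "card ({..<2 ^ (n - l)} \<times> {..<2 ^ l} :: (nat \<times> nat) set) = card {..<2 ^ n :: nat}"
    using ln by (simp add: card_cartesian_product flip: power_add)
  ultimately have bij: "\<Phi> ` {..<2 ^ n} = {..<2 ^ (n - l)} \<times> {..<2 ^ l}"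
    by (intro card_subset_eq) (simp_all add: card_image)
  have mem: "\<tau> \<in> S \<longleftrightarrow> \<tau> < 2 ^ n \<and> \<Phi> \<tau> \<in> {i * 2 ^ m..<(i + 1) * 2 ^ m} \<times> {j}" for \<tau>
  proof -
    \<comment> \<open>The level-\<open>k\<close> condition factors through the finer first component
      of \<open>\<Phi>\<close>, where it cuts out a block of \<open>2 ^ m\<close> consecutive
      values.\<close>
    have "n - k = l + m" using kl by (simp add: m_def)
    then have "drop_bit (n - k) \<tau> = drop_bit m (drop_bit l \<tau>)"
      by (simp only: drop_bit_drop_bit add.commute)
    moreover have "drop_bit m x = i \<longleftrightarrow> i * 2 ^ m \<le> x \<and> x < (i + 1) * 2 ^ m" for x
      using less_eq_div_iff_mult_less_eq[of "2 ^ m" i x] div_less_iff_less_mult[of "2 ^ m" x "i + 1"]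
      by (auto simp: drop_bit_eq_div simp del: mult_Suc)
    ultimately show ?thesis
      unfolding S_def \<Phi>_def vdc_point_def dyadic_rect_def mem_Collect_eq mem_Times_iff fst_conv snd_conv
        cell_mid_mem_dyadic_ivl[OF ln(1)] cell_mid_mem_dyadic_ivl[OF ln(2)]
      by (metis atLeastLessThan_iff singleton_iff)
  qed
  have "(i + 1) * 2 ^ m \<le> 2 ^ k * 2 ^ m"
    using i by (intro mult_right_mono) auto
  also have "2 ^ k * 2 ^ m = (2 :: nat) ^ (n - l)"
    using kl by (simp add: m_def flip: power_add)
  finally have sub: "{i * 2 ^ m..<(i + 1) * 2 ^ m} \<times> {j} \<subseteq> \<Phi> ` {..<2 ^ n}"
    unfolding bij using j by auto
  have image_inter_vimage: "\<Phi> ` (T \<inter> \<Phi> -` D) = \<Phi> ` T \<inter> D" for T D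
    by blast
  have "S = {..<2 ^ n} \<inter> \<Phi> -` ({i * 2 ^ m..<(i + 1) * 2 ^ m} \<times> {j})"
    by (rule set_eqI) (simp only: mem Int_iff vimage_eq lessThan_iff)
  then have "\<Phi> ` S = \<Phi> ` {..<2 ^ n} \<inter> {i * 2 ^ m..<(i + 1) * 2 ^ m} \<times> {j}"
    using image_inter_vimage by (simp only:)
  with sub have "\<Phi> ` S = {i * 2 ^ m..<(i + 1) * 2 ^ m} \<times> {j}"
    by (simp only: Int_absorb1)
  moreover have "inj_on \<Phi> S"
    using \<open>inj_on \<Phi> {..<2 ^ n}\<close> by (rule inj_on_subset) (auto simp: S_def)
  ultimately have "card S = card ({i * 2 ^ m..<(i + 1) * 2 ^ m} \<times> {j})"
    by (metis card_image)
  then show ?thesis by (simp add: S_def m_def card_cartesian_product)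
qed

section \<open>Sums of tent functions over the points\<close>

definition tent :: "dyadic \<Rightarrow> real \<Rightarrow> real" where
  "tent I t = (case I of (k, j) \<Rightarrow> max 0 (min (t - real j / 2 ^ k) ((real j + 1) / 2 ^ k - t)))"

lemma tent_nonneg: "0 \<le> tent I t"
  by (simp add: tent_def split: prod.split)

lemma tent_le: "tent (k, j) t \<le> 1 / 2 ^ Suc k"
proof -
  define a h where "a = real j / 2 ^ k" and "h = (1::real) / 2 ^ Suc k"
  have "tent (k, j) t = max 0 (min (t - a) (a + 2 * h - t))"
    by (simp add: tent_def a_def h_def add_divide_distrib)
  moreover have "h \<ge> 0" by (simp add: h_def)
  ultimately show ?thesis unfolding h_def[symmetric] by linarith
qed

lemma tent_eq_0: "t \<notin> dyadic_ivl I \<Longrightarrow> tent I t = 0"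
  by (auto simp: tent_def dyadic_ivl_def split: prod.splits)

lemma tent_lipschitz: "\<bar>tent I t - tent I u\<bar> \<le> \<bar>t - u\<bar>"
  by (cases I) (simp add: tent_def)

text \<open>Points half an interval apart lie on opposite slopes of the hat, so what one value gains
  in height the other loses.\<close>

lemma tent_half_shift:
  assumes "t \<in> dyadic_ivl (k, j)" "u \<in> dyadic_ivl (k, j)" "\<bar>u - t\<bar> = 1 / 2 ^ Suc k"
  shows "tent (k, j) t + tent (k, j) u = 1 / 2 ^ Suc k"
proof -
  define a h where "a = real j / 2 ^ k" and "h = (1::real) / 2 ^ Suc k"
  have tent: "tent (k, j) v = max 0 (min (v - a) (a + 2 * h - v))" for v
    by (simp add: tent_def a_def h_def add_divide_distrib)
  have "a \<le> t" "t < a + 2 * h" "a \<le> u" "u < a + 2 * h"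
    using assms by (auto simp: dyadic_ivl_def a_def h_def add_divide_distrib)
  then show ?thesis
    using assms(3) unfolding h_def[symmetric] tent by linarith
qed

text \<open>A cell centre is an odd multiple of \<open>1 / 2 ^ (n + 1)\<close>, hence a grid point
  of level \<open>k\<close>, and is never interior to an interval of that level.\<close>

lemma tent_cell_mid_eq_0:
  assumes "n < k"
  shows "tent (k, j) (cell_mid n \<tau>) = 0"
proof -
  define m where "m = (2 * \<tau> + 1) * 2 ^ (k - n - 1)"
  have "k = Suc n + (k - n - 1)" using assms by simp
  from arg_cong[OF this, of "\<lambda>e. (2::real) ^ e"]
  have "(2::real) ^ k = 2 ^ n * 2 * 2 ^ (k - n - 1)"
    unfolding power_add power_Suc by (simp add: mult_ac)
  then have "cell_mid n \<tau> = real m / 2 ^ k"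
    by (simp add: cell_mid_def m_def field_simps)
  moreover have "m \<le> j \<or> j + 1 \<le> m" by linarith
  then have "real m \<le> real j \<or> real j + 1 \<le> real m" by linarith
  then have "real m / 2 ^ k \<le> real j / 2 ^ k \<or> (real j + 1) / 2 ^ k \<le> real m / 2 ^ k"
    by (auto intro: divide_right_mono)
  ultimately show ?thesis unfolding tent_def prod.case by linarith
qed

text \<open>Averaging over \<open>A\<close> replaces \<open>g\<^sub>1\<close> by its mean up to the increments of \<open>g\<^sub>2\<close> along \<open>A\<close>;
  these increments change sign under \<open>B\<close>, so averaging over \<open>B\<close> gains a second factor.\<close>

lemma involution_cancellation:
  fixes g\<^sub>1 g\<^sub>2 :: "'a \<Rightarrow> real"
  assumes S: "\<And>x. x \<in> S \<Longrightarrow> A x \<in> S" "\<And>x. x \<in> S \<Longrightarrow> B x \<in> S"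
    and inv: "\<And>x. x \<in> S \<Longrightarrow> A (A x) = x" "\<And>x. x \<in> S \<Longrightarrow> B (B x) = x"
    and comm: "\<And>x. x \<in> S \<Longrightarrow> A (B x) = B (A x)"
    and g\<^sub>1: "\<And>x. x \<in> S \<Longrightarrow> g\<^sub>1 x + g\<^sub>1 (A x) = a" "\<And>x. x \<in> S \<Longrightarrow> \<bar>g\<^sub>1 (B x) - g\<^sub>1 x\<bar> \<le> d\<^sub>1"
    and g\<^sub>2: "\<And>x. x \<in> S \<Longrightarrow> g\<^sub>2 x + g\<^sub>2 (B x) = b" "\<And>x. x \<in> S \<Longrightarrow> \<bar>g\<^sub>2 (A x) - g\<^sub>2 x\<bar> \<le> d\<^sub>2"
  shows "\<bar>(\<Sum>x\<in>S. g\<^sub>1 x * g\<^sub>2 x) - real (card S) * a * b / 4\<bar> \<le> real (card S) * d\<^sub>1 * d\<^sub>2 / 4"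
proof -
  have sumA: "(\<Sum>x\<in>S. f (A x)) = sum f S" and sumB: "(\<Sum>x\<in>S. f (B x)) = sum f S" for f :: "'a \<Rightarrow> real"
    by (rule sum.reindex_bij_witness[of _ A A], use S inv in auto)
       (rule sum.reindex_bij_witness[of _ B B], use S inv in auto)
  define e where "e x = g\<^sub>2 (A x) - g\<^sub>2 x" for x
  have eB: "e (B x) = - e x" if "x \<in> S" for x
    using that g\<^sub>2(1)[of x] g\<^sub>2(1)[of "A x"] S comm by (simp add: e_def)
  have "2 * (\<Sum>x\<in>S. g\<^sub>2 x) = (\<Sum>x\<in>S. g\<^sub>2 x + g\<^sub>2 (B x))"
    by (simp add: sum.distrib sumB)
  then have sum_g\<^sub>2: "2 * (\<Sum>x\<in>S. g\<^sub>2 x) = real (card S) * b"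
    by (simp add: g\<^sub>2(1))
  have "2 * (\<Sum>x\<in>S. g\<^sub>1 (A x) * e x) = (\<Sum>x\<in>S. g\<^sub>1 (A x) * e x) + (\<Sum>x\<in>S. g\<^sub>1 (A (B x)) * e (B x))"
    using sumB[of "\<lambda>x. g\<^sub>1 (A x) * e x"] by simp
  also have "\<dots> = (\<Sum>x\<in>S. (g\<^sub>1 (A x) - g\<^sub>1 (B (A x))) * e x)"
    unfolding sum.distrib[symmetric] by (rule sum.cong) (simp_all add: eB comm algebra_simps)
  finally have "2 * \<bar>\<Sum>x\<in>S. g\<^sub>1 (A x) * e x\<bar> = \<bar>\<Sum>x\<in>S. (g\<^sub>1 (A x) - g\<^sub>1 (B (A x))) * e x\<bar>"
    by linarith
  also have "\<dots> \<le> (\<Sum>x\<in>S. \<bar>(g\<^sub>1 (A x) - g\<^sub>1 (B (A x))) * e x\<bar>)"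
    by (rule sum_abs)
  also have "\<dots> \<le> (\<Sum>x\<in>S. d\<^sub>1 * d\<^sub>2)"
    unfolding abs_mult e_def
    using g\<^sub>1(2)[OF S(1)] g\<^sub>2(2) by (intro sum_mono mult_mono) (auto simp: abs_minus_commute intro: order_trans[OF abs_ge_zero])
  finally have E: "2 * \<bar>\<Sum>x\<in>S. g\<^sub>1 (A x) * e x\<bar> \<le> real (card S) * d\<^sub>1 * d\<^sub>2"
    by simp
  \<comment> \<open>Pairing \<open>x\<close> with \<open>A x\<close> and writing
    \<open>g\<^sub>1 x = a - g\<^sub>1 (A x)\<close> leaves the mean part and the increment term
    bounded in \<open>E\<close>.\<close>
  have "2 * (\<Sum>x\<in>S. g\<^sub>1 x * g\<^sub>2 x) = (\<Sum>x\<in>S. g\<^sub>1 x * g\<^sub>2 x) + (\<Sum>x\<in>S. g\<^sub>1 (A x) * g\<^sub>2 (A x))"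
    using sumA[of "\<lambda>x. g\<^sub>1 x * g\<^sub>2 x"] by simp
  also have "\<dots> = (\<Sum>x\<in>S. a * g\<^sub>2 x + g\<^sub>1 (A x) * e x)"
    unfolding sum.distrib[symmetric]
    by (rule sum.cong) (simp_all add: e_def algebra_simps flip: g\<^sub>1(1))
  also have "\<dots> = a * (\<Sum>x\<in>S. g\<^sub>2 x) + (\<Sum>x\<in>S. g\<^sub>1 (A x) * e x)"
    by (simp add: sum.distrib sum_distrib_left)
  finally have "4 * (\<Sum>x\<in>S. g\<^sub>1 x * g\<^sub>2 x) = a * (2 * (\<Sum>x\<in>S. g\<^sub>2 x)) + 2 * (\<Sum>x\<in>S. g\<^sub>1 (A x) * e x)"
    by simp
  then have "4 * (\<Sum>x\<in>S. g\<^sub>1 x * g\<^sub>2 x) = real (card S) * a * b + 2 * (\<Sum>x\<in>S. g\<^sub>1 (A x) * e x)"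
    unfolding sum_g\<^sub>2 by (simp add: mult_ac)
  with E show ?thesis by linarith
qed

definition tent_sum :: "nat \<Rightarrow> (nat \<Rightarrow> bool) \<Rightarrow> dyadic \<times> dyadic \<Rightarrow> real" where
  "tent_sum n s R = (\<Sum>\<tau><2 ^ n. tent (fst R) (fst (vdc_point n s \<tau>)) * tent (snd R) (snd (vdc_point n s \<tau>)))"

lemma tent_sum_restrict:
  "tent_sum n s R = (\<Sum>\<tau> | \<tau> < 2 ^ n \<and> vdc_point n s \<tau> \<in> dyadic_rect R.
     tent (fst R) (fst (vdc_point n s \<tau>)) * tent (snd R) (snd (vdc_point n s \<tau>)))"
  unfolding tent_sum_def
  by (rule sum.mono_neutral_right) (use tent_eq_0[of _ "fst R"] tent_eq_0[of _ "snd R"] in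
      \<open>auto simp: dyadic_rect_def mem_Times_iff\<close>)

lemma tent_sum_nonneg: "0 \<le> tent_sum n s R"
  unfolding tent_sum_def by (intro sum_nonneg mult_nonneg_nonneg tent_nonneg)

lemma tent_sum_le_card:
  "tent_sum n s ((k, i), (l, j))
     \<le> real (card {\<tau>. \<tau> < 2 ^ n \<and> vdc_point n s \<tau> \<in> dyadic_rect ((k, i), (l, j))}) / (4 * 2 ^ (k + l))"
proof -
  have "tent_sum n s ((k, i), (l, j)) \<le> (\<Sum>\<tau> | \<tau> < 2 ^ n \<and> vdc_point n s \<tau> \<in> dyadic_rect ((k, i), (l, j)).
      1 / 2 ^ Suc k * (1 / 2 ^ Suc l))"
    unfolding tent_sum_restrict fst_conv snd_conv
    by (intro sum_mono mult_mono tent_le tent_nonneg) simp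
  then show ?thesis by (simp add: power_add)
qed

text \<open>The rectangle holds \<open>N |R|\<close> points. The tents have half-sums of product
  \<open>|R| / 16\<close>, which gives the main term. The two cross moves have sizes
  \<open>2 ^ l / N\<close> and \<open>2 ^ k / N\<close>, so \<open>involution_cancellation\<close>
  leaves an error of \<open>1 / (4 N)\<close>.\<close>

lemma tent_sum_approx:
  assumes kl: "k + l \<le> n" and i: "i < 2 ^ k" and j: "j < 2 ^ l"
  shows "\<bar>tent_sum n s ((k, i), (l, j)) - 2 ^ n / (16 * 4 ^ (k + l))\<bar> \<le> 1 / 2 ^ n"
proof -
  define S where "S = {\<tau>. \<tau> < 2 ^ n \<and> vdc_point n s \<tau> \<in> dyadic_rect ((k, i), (l, j))}"
  have "card S = 2 ^ (n - k - l)"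
    using card_vdc_point_rect[OF assms] by (simp add: S_def)
  then have cardS: "real (card S) = 2 ^ n / 2 ^ (k + l)"
    by (simp only: of_nat_power of_nat_numeral diff_diff_left power_diff[OF _ kl, of "2::real"])
  have four: "(4::real) ^ (k + l) = 2 ^ (k + l) * 2 ^ (k + l)"
    by (simp flip: power_mult_distrib)
  show ?thesis
  proof (cases "k + l + 2 \<le> n")
    case False
    \<comment> \<open>For \<open>n <= k + l + 1\<close> both the tent sum and the subtracted term
      already lie between \<open>0\<close> and \<open>1 / 2 ^ n\<close>.\<close>
    have "(2::real) ^ n \<le> 2 ^ Suc (k + l)" using False by (intro power_increasing) auto
    then have a: "2 ^ n \<le> (2::real) * 2 ^ (k + l)" by simp
    then have b: "(2 ^ n)\<^sup>2 \<le> ((2::real) * 2 ^ (k + l))\<^sup>2" by (intro power_mono) auto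
    have "tent_sum n s ((k, i), (l, j)) \<le> 2 ^ n / (4 * 4 ^ (k + l))"
      using tent_sum_le_card[of n s k i l j, folded S_def] unfolding cardS four by (simp add: mult_ac)
    also have le: "\<dots> \<le> 1 / 2 ^ n"
      using b by (simp add: four field_simps power2_eq_square)
    finally have "tent_sum n s ((k, i), (l, j)) \<le> 1 / 2 ^ n" .
    moreover have "2 ^ n / (16 * 4 ^ (k + l)) \<le> (2::real) ^ n / (4 * 4 ^ (k + l))"
      by (intro divide_left_mono) auto
    moreover have "0 \<le> (2::real) ^ n / (16 * 4 ^ (k + l))" by simp
    ultimately show ?thesis
      using le tent_sum_nonneg[of n s "((k, i), (l, j))"] by linarith
  next
    case True
    \<comment> \<open>\<open>A\<close> flips the bit that selects the half of the first side; in the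
      second coordinate it changes bit \<open>k\<close>. \<open>B\<close> flips bit \<open>l\<close>
      of \<tau>, which is the half-selecting bit \<open>n - l - 1\<close> of the second coordinate.
      Both moves stay inside the rectangle.\<close>
    define A :: "nat \<Rightarrow> nat" where "A = flip_bit (n - k - 1)"
    define B :: "nat \<Rightarrow> nat" where "B = flip_bit l"
    define x where "x \<tau> = cell_mid n \<tau>" for \<tau>
    define y where "y \<tau> = cell_mid n (scramble n s \<tau>)" for \<tau>
    have S_iff: "\<tau> \<in> S \<longleftrightarrow> \<tau> < 2 ^ n \<and> drop_bit (n - k) \<tau> = i \<and> drop_bit (n - l) (scramble n s \<tau>) = j" for \<tau>
      using kl by (auto simp: S_def vdc_point_def dyadic_rect_def cell_mid_mem_dyadic_ivl)
    have scrA: "scramble n s (A \<tau>) = flip_bit k (scramble n s \<tau>)"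
      and scrB: "scramble n s (B \<tau>) = flip_bit (n - l - 1) (scramble n s \<tau>)" for \<tau>
      using True by (simp_all add: A_def B_def scramble_flip_bit)
    have A: "A \<tau> \<in> S" and B: "B \<tau> \<in> S" if "\<tau> \<in> S" for \<tau>
      using that True unfolding S_iff scrA scrB
      by (auto simp: A_def B_def drop_bit_flip_bit intro: flip_bit_less)
    have xS: "x \<tau> \<in> dyadic_ivl (k, i)" and yS: "y \<tau> \<in> dyadic_ivl (l, j)" if "\<tau> \<in> S" for \<tau>
      using that by (auto simp: S_def x_def y_def vdc_point_def dyadic_rect_def)
    have pow: "(2::real) ^ (n - k - 1) / 2 ^ n = 1 / 2 ^ Suc k" "(2::real) ^ (n - l - 1) / 2 ^ n = 1 / 2 ^ Suc l"
      using True by (simp_all add: power_diff flip: diff_diff_left)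
    have xA: "\<bar>x (A \<tau>) - x \<tau>\<bar> = 1 / 2 ^ Suc k" and xB: "\<bar>x (B \<tau>) - x \<tau>\<bar> = 2 ^ l / 2 ^ n"
      and yA: "\<bar>y (A \<tau>) - y \<tau>\<bar> = 2 ^ k / 2 ^ n" and yB: "\<bar>y (B \<tau>) - y \<tau>\<bar> = 1 / 2 ^ Suc l" for \<tau>
      unfolding x_def y_def scrA scrB
      by (simp_all only: A_def B_def abs_diff_cell_mid_flip_bit pow)
    have main: "\<bar>(\<Sum>\<tau>\<in>S. tent (k, i) (x \<tau>) * tent (l, j) (y \<tau>)) - real (card S) * (1 / 2 ^ Suc k) * (1 / 2 ^ Suc l) / 4\<bar>
        \<le> real (card S) * (2 ^ l / 2 ^ n) * (2 ^ k / 2 ^ n) / 4"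
    proof (rule involution_cancellation[where A = A and B = B])
      fix \<tau> assume \<tau>: "\<tau> \<in> S"
      show "A \<tau> \<in> S" "B \<tau> \<in> S" using \<tau> by (fact A B)+
      show "A (A \<tau>) = \<tau>" "B (B \<tau>) = \<tau>" by (simp_all add: A_def B_def flip_bit_flip_bit)
      show "A (B \<tau>) = B (A \<tau>)" unfolding A_def B_def by (rule flip_bit_commute)
      show "tent (k, i) (x \<tau>) + tent (k, i) (x (A \<tau>)) = 1 / 2 ^ Suc k"
        using \<tau> A xS xA by (intro tent_half_shift) auto
      show "tent (l, j) (y \<tau>) + tent (l, j) (y (B \<tau>)) = 1 / 2 ^ Suc l"
        using \<tau> B yS yB by (intro tent_half_shift) auto
      show "\<bar>tent (k, i) (x (B \<tau>)) - tent (k, i) (x \<tau>)\<bar> \<le> 2 ^ l / 2 ^ n"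
        using tent_lipschitz[of "(k, i)" "x (B \<tau>)" "x \<tau>"] xB by simp
      show "\<bar>tent (l, j) (y (A \<tau>)) - tent (l, j) (y \<tau>)\<bar> \<le> 2 ^ k / 2 ^ n"
        using tent_lipschitz[of "(l, j)" "y (A \<tau>)" "y \<tau>"] yA by simp
    qed
    have "(\<Sum>\<tau>\<in>S. tent (k, i) (x \<tau>) * tent (l, j) (y \<tau>)) = tent_sum n s ((k, i), (l, j))"
      by (simp add: tent_sum_restrict S_def x_def y_def vdc_point_def)
    moreover have "real (card S) * (1 / 2 ^ Suc k) * (1 / 2 ^ Suc l) / 4 = 2 ^ n / (16 * 4 ^ (k + l))"
      unfolding cardS four by (simp add: power_add)
    moreover have "real (card S) * (2 ^ l / 2 ^ n) * (2 ^ k / 2 ^ n) / 4 = (1 / 2 ^ n) / 4"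
      unfolding cardS by (simp add: power_add)
    ultimately have "\<bar>tent_sum n s ((k, i), (l, j)) - 2 ^ n / (16 * 4 ^ (k + l))\<bar> \<le> (1 / 2 ^ n) / 4"
      using main by (simp only:)
    also have "\<dots> \<le> 1 / 2 ^ n" by (simp only: divide_le_eq) simp
    finally show ?thesis .
  qed
qed

section \<open>Haar coefficients of the discrepancy\<close>

lemma measurable_haar [measurable]: "haar I \<in> borel_measurable borel"
  unfolding haar_def dyadic_ivl_def left_half_def right_half_def by (cases I) simp

lemma haar_eq_interval:
  "haar (k, j) x = - indicator {real j / 2 ^ k ..< real j / 2 ^ k + 1 / 2 ^ Suc k} x
     + indicator {real j / 2 ^ k + 1 / 2 ^ Suc k ..< real j / 2 ^ k + 2 * (1 / 2 ^ Suc k)} x"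
proof -
  have "real (2 * j) / 2 ^ Suc k = real j / 2 ^ k"
    "(real (2 * j) + 1) / 2 ^ Suc k = real j / 2 ^ k + 1 / 2 ^ Suc k"
    "real (2 * j + 1) / 2 ^ Suc k = real j / 2 ^ k + 1 / 2 ^ Suc k"
    "(real (2 * j + 1) + 1) / 2 ^ Suc k = real j / 2 ^ k + 2 * (1 / 2 ^ Suc k)"
    by (simp_all add: add_divide_distrib)
  then show ?thesis
    by (simp only: haar_def left_half_def right_half_def dyadic_ivl_def prod.case)
qed

lemma abs_haar_le_1: "\<bar>haar I x\<bar> \<le> 1"
  by (cases I) (auto simp: haar_eq_interval split: split_indicator)

lemma dyadic_ivl_bounds:
  assumes "(k, j) \<in> dyadics"
  shows "0 \<le> real j / 2 ^ k" "real j / 2 ^ k + 2 * (1 / 2 ^ Suc k) \<le> 1"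
proof -
  have "j + 1 \<le> 2 ^ k" using assms by (simp add: dyadics_def)
  then have "real (j + 1) \<le> real (2 ^ k)" by (simp only: of_nat_le_iff)
  then have "(real j + 1) / 2 ^ k \<le> 1" by simp
  then show "real j / 2 ^ k + 2 * (1 / 2 ^ Suc k) \<le> 1" by (simp add: add_divide_distrib)
qed simp

lemma set_integrable_unit_haar:
  assumes "f \<in> borel_measurable borel" "\<And>x. x \<in> {0..1} \<Longrightarrow> \<bar>f x\<bar> \<le> 1"
  shows "set_integrable lborel {0..1} (\<lambda>x. f x * haar I x)"
  unfolding set_integrable_def
proof (rule Bochner_Integration.integrable_bound)
  show "integrable lborel (indicator {0..1::real} :: real \<Rightarrow> real)" by simp
  show "(\<lambda>x. indicat_real {0..1} x *\<^sub>R (f x * haar I x)) \<in> borel_measurable lborel"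
    using assms(1) by simp
  show "AE x in lborel. norm (indicat_real {0..1} x *\<^sub>R (f x * haar I x)) \<le> norm (indicat_real {0..1} x)"
    using assms(2) abs_haar_le_1[of I]
    by (auto simp: abs_mult split: split_indicator intro!: mult_le_one AE_I2)
qed

text \<open>A point with coordinate \<open>t\<close> is counted in \<open>[0, u)\<close> exactly
  when \<open>t < u\<close>, so this is the one-variable Haar coefficient of its contribution. It is
  the difference of the lengths of the two halves to the right of \<open>t\<close>.\<close>

lemma integral_greater_haar:
  assumes I: "I \<in> dyadics"
  shows "(LBINT x:{0..1}. indicator {t<..} x * haar I x) = tent I t"
proof (cases I)
  case (Pair k j)
  define a h where "a = real j / 2 ^ k" and "h = (1::real) / 2 ^ Suc k"
  have ah: "0 \<le> a" "a + 2 * h \<le> 1" "h \<ge> 0"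
    using I dyadic_ivl_bounds[of k j] by (simp_all add: Pair a_def h_def)
  have m: "measure lborel ({t<..} \<inter> {c..<d}) = max 0 (d - max c t)" for c d :: real
  proof (cases "c \<le> t")
    case True
    then have "{t<..} \<inter> {c..<d} = {t<..<d}" by auto
    with True show ?thesis by (cases "t \<le> d") auto
  next
    case False
    then have "{t<..} \<inter> {c..<d} = {c..<d}" by auto
    with False show ?thesis by (cases "c \<le> d") auto
  qed
  have fin: "emeasure lborel ({t<..} \<inter> {c..<d}) < \<infinity>" for c d :: real
    by (rule emeasure_bounded_finite[OF bounded_subset[OF bounded_closed_interval[of c d]]]) auto
  have "(LBINT x:{0..1}. indicator {t<..} x * haar I x)
      = (LBINT x. - indicator ({t<..} \<inter> {a..<a + h}) x + indicator ({t<..} \<inter> {a + h..<a + 2 * h}) x)"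
    unfolding set_lebesgue_integral_def Pair haar_eq_interval a_def[symmetric] h_def[symmetric]
    using ah by (intro Bochner_Integration.integral_cong) (auto split: split_indicator)
  also have "\<dots> = - max 0 (a + h - max a t) + max 0 (a + 2 * h - max (a + h) t)"
    using fin by (subst Bochner_Integration.integral_add) (auto simp: m)
  also have "\<dots> = max 0 (min (t - a) (a + 2 * h - t))"
    using ah by linarith
  also have "\<dots> = tent I t"
    by (simp add: Pair tent_def a_def h_def add_divide_distrib)
  finally show ?thesis .
qed

text \<open>One-variable factor of the linear part. With \<open>h\<close> half the length, the
  identity is larger by \<open>h\<close> on the right half than at the matching point of the left
  half, which integrates to \<open>h\<^sup>2\<close>.\<close>

lemma integral_ident_haar:
  assumes I: "(k, j) \<in> dyadics"
  shows "(LBINT x:{0..1}. x * haar (k, j) x) = 1 / (4 * 4 ^ k)"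
proof -
  define a h where "a = real j / 2 ^ k" and "h = (1::real) / 2 ^ Suc k"
  have ah: "0 \<le> a" "a + 2 * h \<le> 1" "h \<ge> 0"
    using dyadic_ivl_bounds[OF I] by (simp_all add: a_def h_def)
  have int: "set_integrable lborel {c..<d} (\<lambda>x. x)" for c d :: real
    by (rule set_integrable_subset[of _ "{c..d}"]) (auto intro: borel_integrable_atLeastAtMost')
  have val: "(LBINT x:{c..<d}. x) = (d\<^sup>2 - c\<^sup>2) / 2" if "c \<le> d" for c d :: real
  proof -
    have "(LBINT x=c..d. x) = d\<^sup>2 / 2 - c\<^sup>2 / 2"
      using that
      by (intro interval_integral_FTC_finite continuous_on_id)
        (auto intro!: derivative_eq_intros simp flip: has_real_derivative_iff_has_vector_derivative)
    then show ?thesis using that by (simp add: interval_integral_Ico diff_divide_distrib)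
  qed
  have "(LBINT x:{0..1}. x * haar (k, j) x)
      = (LBINT x. - (indicator {a..<a + h} x *\<^sub>R x) + indicator {a + h..<a + 2 * h} x *\<^sub>R x)"
    unfolding set_lebesgue_integral_def haar_eq_interval a_def[symmetric] h_def[symmetric]
    using ah by (intro Bochner_Integration.integral_cong) (auto split: split_indicator)
  also have "\<dots> = - (LBINT x:{a..<a + h}. x) + (LBINT x:{a + h..<a + 2 * h}. x)"
    using int[of a "a + h"] int[of "a + h" "a + 2 * h"] unfolding set_lebesgue_integral_def set_integrable_def
    by (subst Bochner_Integration.integral_add) auto
  also have "\<dots> = h\<^sup>2"
    using ah by (simp add: val power2_eq_square field_simps)
  also have "h\<^sup>2 = 1 / (4 * 4 ^ k)"
    by (simp add: h_def power2_eq_square flip: power_mult_distrib)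
  finally show ?thesis .
qed

text \<open>Fubini for a product of one-variable functions. \<open>inner_L2\<close> integrates
  against the completed measure, which agrees with the product of two \<open>lborel\<close> on Borel
  functions.\<close>

lemma set_integral_prod_lebesgue:
  fixes f g :: "real \<Rightarrow> real"
  assumes [measurable]: "f \<in> borel_measurable borel" "g \<in> borel_measurable borel" "A \<in> sets borel" "B \<in> sets borel"
    and f: "set_integrable lborel A f" and g: "set_integrable lborel B g"
  shows "set_integrable lebesgue (A \<times> B) (\<lambda>x. f (fst x) * g (snd x))"
    and "(LINT x:A \<times> B|lebesgue. f (fst x) * g (snd x)) = (LBINT x:A. f x) * (LBINT y:B. g y)"
proof -
  define F where "F x = indicator A x * f x" for x
  define G where "G x = indicator B x * g x" for x
  have [measurable]: "F \<in> borel_measurable borel" "G \<in> borel_measurable borel"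
    unfolding F_def G_def by measurable
  have F: "integrable lborel F" and G: "integrable lborel G"
    using f g by (simp_all add: set_integrable_def F_def[abs_def] G_def[abs_def])
  have FG: "indicator (A \<times> B) x *\<^sub>R (f (fst x) * g (snd x)) = F (fst x) * G (snd x)" for x
    by (cases x) (simp add: F_def G_def indicator_times)
  have meas: "(\<lambda>x. F (fst x) * G (snd x)) \<in> borel_measurable (lborel :: (real \<times> real) measure)"
    unfolding lborel_prod[symmetric] by measurable
  have int: "integrable (lborel \<Otimes>\<^sub>M lborel) (\<lambda>x. F (fst x) * G (snd x))"
  proof (rule lborel_pair.Fubini_integrable)
    show "(\<lambda>x. F (fst x) * G (snd x)) \<in> borel_measurable (lborel \<Otimes>\<^sub>M lborel)" by measurable
    show "integrable lborel (\<lambda>x. LBINT y. norm (F (fst (x, y)) * G (snd (x, y))))"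
      using F by (simp add: abs_mult)
    show "AE x in lborel. integrable lborel (\<lambda>y. F (fst (x, y)) * G (snd (x, y)))"
      using G by simp
  qed
  show "set_integrable lebesgue (A \<times> B) (\<lambda>x. f (fst x) * g (snd x))"
    unfolding set_integrable_def FG using int meas by (simp add: integrable_completion lborel_prod)
  have "(LINT x:A \<times> B|lebesgue. f (fst x) * g (snd x)) = integral\<^sup>L (lborel \<Otimes>\<^sub>M lborel) (\<lambda>x. F (fst x) * G (snd x))"
    unfolding set_lebesgue_integral_def FG using meas by (simp add: integral_completion lborel_prod)
  also have "\<dots> = (LBINT x. LBINT y. F x * G y)"
    using lborel_pair.integral_fst'[OF int] by simp
  also have "\<dots> = (LBINT x. F x) * (LBINT y. G y)"
    by simp
  finally show "(LINT x:A \<times> B|lebesgue. f (fst x) * g (snd x)) = (LBINT x:A. f x) * (LBINT y:B. g y)"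
    by (simp add: set_lebesgue_integral_def F_def[abs_def] G_def[abs_def])
qed

text \<open>The counting function is a sum over points of products of indicators and the linear part
  is a product as well, so the coefficient splits into one-variable integrals.\<close>

lemma inner_L2_discrepancy:
  assumes R: "(k, i) \<in> dyadics" "(l, j) \<in> dyadics"
  shows "inner_L2 (discrepancy (vdc_set n \<sigma>)) (haar_rect ((k, i), (l, j)))
    = tent_sum n (\<lambda>i. bin_digit (n - i) \<sigma> = 1) ((k, i), (l, j)) - 2 ^ n / (16 * 4 ^ (k + l))"
proof -
  define s where "s = (\<lambda>i. bin_digit (n - i) \<sigma> = 1)"
  define I J where "I = (k, i)" and "J = (l, j)"
  define x y where "x \<tau> = fst (vdc_point n s \<tau>)" and "y \<tau> = snd (vdc_point n s \<tau>)" for \<tau>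
  have V: "vdc_set n \<sigma> = vdc_point n s ` {..<2 ^ n}"
    by (simp add: vdc_set_eq s_def)
  have count: "real (card (vdc_set n \<sigma> \<inter> {0..<u} \<times> {0..<v}))
      = (\<Sum>\<tau><2 ^ n. indicator {x \<tau><..} u * indicator {y \<tau><..} v)" for u v
  proof -
    have pt: "vdc_point n s \<tau> = (x \<tau>, y \<tau>)" for \<tau> by (simp add: x_def y_def)
    \<comment> \<open>Nonnegative coordinates make the lower bound \<open>0\<close> of the counting
      box automatic.\<close>
    have "0 \<le> x \<tau>" "0 \<le> y \<tau>" for \<tau> by (simp_all add: x_def y_def vdc_point_def cell_mid_def)
    then have "vdc_set n \<sigma> \<inter> {0..<u} \<times> {0..<v} = vdc_point n s ` ({..<2 ^ n} \<inter> {\<tau>. x \<tau> < u \<and> y \<tau> < v})"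
      unfolding V by (auto simp: pt)
    then have "real (card (vdc_set n \<sigma> \<inter> {0..<u} \<times> {0..<v})) = (\<Sum>\<tau><2 ^ n. of_bool (x \<tau> < u \<and> y \<tau> < v))"
      by (simp add: card_image inj_on_subset[OF inj_vdc_point])
    then show ?thesis
      by (simp add: indicator_def of_bool_conj)
  qed
  define P where "P \<tau> z = (indicator {x \<tau><..} (fst z) * haar I (fst z)) * (indicator {y \<tau><..} (snd z) * haar J (snd z))"
    for \<tau> and z :: "real \<times> real"
  define Q where "Q z = (fst z * haar I (fst z)) * (snd z * haar J (snd z))" for z :: "real \<times> real"
  have D: "discrepancy (vdc_set n \<sigma>) z * haar_rect (I, J) z = (\<Sum>\<tau><2 ^ n. P \<tau> z) - 2 ^ n * Q z" for z
    unfolding discrepancy_def count card_vdc_set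
    by (simp only: P_def Q_def haar_rect_def right_diff_distrib sum_distrib_left fst_conv snd_conv
        of_nat_power of_nat_numeral mult_ac)
  have ind: "set_integrable lborel {0..1} (\<lambda>u. indicator {t<..} u * haar K u)"
    and idt: "set_integrable lborel {0..1} (\<lambda>u. u * haar K u)" for t :: real and K
    by (rule set_integrable_unit_haar; simp add: indicator_def)+
  have intP: "set_integrable lebesgue unit_square (P \<tau>)"
    and valP: "(LINT z:unit_square|lebesgue. P \<tau> z) = tent I (x \<tau>) * tent J (y \<tau>)" for \<tau>
    unfolding P_def integral_greater_haar[OF R(1)[folded I_def], symmetric] integral_greater_haar[OF R(2)[folded J_def], symmetric]
    by (rule set_integral_prod_lebesgue; use ind in simp)+
  have intQ: "set_integrable lebesgue unit_square Q"
    and valQ: "(LINT z:unit_square|lebesgue. Q z) = 1 / (4 * 4 ^ k) * (1 / (4 * 4 ^ l))"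
    unfolding Q_def integral_ident_haar[OF R(1), symmetric] integral_ident_haar[OF R(2), symmetric] I_def[symmetric] J_def[symmetric]
    by (rule set_integral_prod_lebesgue; use idt in simp)+
  define p where "p \<tau> z = indicator unit_square z *\<^sub>R P \<tau> z" for \<tau> z
  define q where "q z = indicator unit_square z *\<^sub>R Q z" for z
  have int: "integrable lebesgue (p \<tau>)" "integrable lebesgue q" for \<tau>
    using intP intQ by (simp_all only: set_integrable_def p_def[abs_def] q_def[abs_def])
  have "inner_L2 (discrepancy (vdc_set n \<sigma>)) (haar_rect (I, J))
      = (LINT z|lebesgue. (\<Sum>\<tau><2 ^ n. p \<tau> z) - 2 ^ n * q z)"
    unfolding inner_L2_def set_lebesgue_integral_def D p_def q_def
    by (simp only: real_scaleR_def right_diff_distrib sum_distrib_left mult.left_commute)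
  also have "\<dots> = (\<Sum>\<tau><2 ^ n. LINT z|lebesgue. p \<tau> z) - 2 ^ n * (LINT z|lebesgue. q z)"
    using int by simp
  also have "\<dots> = (\<Sum>\<tau><2 ^ n. LINT z:unit_square|lebesgue. P \<tau> z) - 2 ^ n * (LINT z:unit_square|lebesgue. Q z)"
    by (simp only: set_lebesgue_integral_def p_def q_def)
  also have "\<dots> = tent_sum n s (I, J) - 2 ^ n / (16 * 4 ^ (k + l))"
    unfolding valP valQ by (simp add: tent_sum_def x_def y_def power_add)
  finally show ?thesis by (simp add: s_def I_def J_def)
qed

section \<open>Summation over dyadic rectangles\<close>

lemma sum_power_le_geometric:
  fixes x :: real
  assumes "finite T" "inj_on f T" "0 \<le> x" "x < 1"
  shows "(\<Sum>t\<in>T. x ^ f t) \<le> 1 / (1 - x)"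
proof -
  have "(\<Sum>t\<in>T. x ^ f t) = (\<Sum>m\<in>f ` T. x ^ m)"
    by (simp add: sum.reindex[OF assms(2)])
  also have "\<dots> \<le> (\<Sum>m. x ^ m)"
    using assms by (intro sum_le_suminf summable_geometric) auto
  also have "\<dots> = 1 / (1 - x)"
    using assms by (simp add: suminf_geometric)
  finally show ?thesis .
qed

text \<open>Subtraction is truncated, so one summand of the exponent vanishes and the value is
  \<open>4\<close> to the power \<open>- |k + l - n|\<close>.\<close>

definition level_weight :: "nat \<Rightarrow> nat \<Rightarrow> nat \<Rightarrow> real" where
  "level_weight n k l = (1 / 4) ^ ((k + l - n) + (n - (k + l)))"

lemma level_weight_nonneg: "0 \<le> level_weight n k l"
  by (simp add: level_weight_def)

text \<open>For fixed \<open>k\<close> the exponent is \<open>(k - n)\<close> plus the distance of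
  \<open>l\<close> from \<open>n - k\<close>, and the two geometric tails give \<open>8 / 3\<close>.
  Over \<open>k\<close> there are \<open>n + 1\<close> terms of size one and another tail.\<close>

lemma sum_level_weight_le: "(\<Sum>k<L. \<Sum>l<L. level_weight n k l) \<le> 3 * real n + 7"
proof -
  have inner: "(\<Sum>l<L. level_weight n k l) \<le> (8 / 3) * (1 / 4) ^ (k - n)" for k
  proof -
    define a where "a = n - k"
    have "level_weight n k l = (1 / 4) ^ (k - n) * (1 / 4) ^ ((l - a) + (a - l))" for l
      unfolding level_weight_def a_def power_add[symmetric] by (rule arg_cong[where f = "\<lambda>e. (1 / 4) ^ e"]) linarith
    then have "(\<Sum>l<L. level_weight n k l) = (1 / 4) ^ (k - n) * (\<Sum>l<L. (1 / 4) ^ ((l - a) + (a - l)))"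
      by (simp add: sum_distrib_left)
    also have "(\<Sum>l<L. (1 / 4 :: real) ^ ((l - a) + (a - l)))
        = (\<Sum>l\<in>{..<L} \<inter> {..a}. (1 / 4) ^ (a - l)) + (\<Sum>l\<in>{..<L} \<inter> - {..a}. (1 / 4) ^ (l - a))"
      by (subst sum.Int_Diff[of _ _ "{..a}"]) (auto simp: Diff_eq intro!: arg_cong2[where f = "(+)"] sum.cong)
    also have "\<dots> \<le> 1 / (1 - 1 / 4) + 1 / (1 - 1 / 4)"
      by (intro add_mono sum_power_le_geometric) (auto simp: inj_on_def)
    finally show ?thesis by (simp add: mult.commute mult_left_mono)
  qed
  have "(\<Sum>k<L. (1 / 4 :: real) ^ (k - n))
      = (\<Sum>k\<in>{..<L} \<inter> {..n}. (1 / 4) ^ (k - n)) + (\<Sum>k\<in>{..<L} \<inter> - {..n}. (1 / 4) ^ (k - n))"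
    by (subst sum.Int_Diff[of _ _ "{..n}"]) (simp_all add: Diff_eq)
  also have "\<dots> \<le> real (card {..n}) + 1 / (1 - 1 / 4)"
  proof (intro add_mono sum_power_le_geometric)
    have "(\<Sum>k\<in>{..<L} \<inter> {..n}. (1 / 4 :: real) ^ (k - n)) = real (card ({..<L} \<inter> {..n}))"
      by simp
    also have "\<dots> \<le> real (card {..n})"
      unfolding of_nat_le_iff by (intro card_mono) auto
    finally show "(\<Sum>k\<in>{..<L} \<inter> {..n}. (1 / 4 :: real) ^ (k - n)) \<le> real (card {..n})" .
  qed (auto simp: inj_on_def)
  finally have "(\<Sum>k<L. (1 / 4 :: real) ^ (k - n)) \<le> real n + 7 / 3" by simp
  moreover have "(\<Sum>k<L. \<Sum>l<L. level_weight n k l) \<le> (8 / 3) * (\<Sum>k<L. (1 / 4) ^ (k - n))"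
    unfolding sum_distrib_left by (intro sum_mono inner)
  ultimately show ?thesis by linarith
qed

section \<open>Packing dyadic rectangles into a set of finite measure\<close>

lemma measure_dyadic_rect:
  "dyadic_rect R \<in> lmeasurable"
  "measure lebesgue (dyadic_rect R) = 1 / 2 ^ (fst (fst R) + fst (snd R))"
proof -
  obtain k i l j where R: "R = ((k, i), (l, j))" by (metis surj_pair)
  have e: "emeasure lborel (dyadic_ivl (k, j)) = ennreal (1 / 2 ^ k)" for k j
  proof -
    have "(real j + 1) / 2 ^ k - real j / 2 ^ k = 1 / 2 ^ k" by (simp add: diff_divide_distrib[symmetric])
    moreover have "real j / 2 ^ k \<le> (real j + 1) / 2 ^ k" by (simp add: divide_right_mono)
    ultimately show ?thesis by (simp add: dyadic_ivl_def)
  qed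
  have s: "dyadic_ivl I \<in> sets borel" for I by (cases I) (simp add: dyadic_ivl_def)
  have "emeasure (lborel \<Otimes>\<^sub>M lborel) (dyadic_rect R) = ennreal (1 / 2 ^ k) * ennreal (1 / 2 ^ l)"
    using s by (simp add: dyadic_rect_def R lborel.emeasure_pair_measure_Times e)
  then have em: "emeasure lborel (dyadic_rect R) = ennreal (1 / 2 ^ (k + l))"
    by (simp add: lborel_prod power_add ennreal_mult[symmetric])
  have b: "dyadic_rect R \<in> sets borel"
    unfolding dyadic_rect_def using s by (metis borel_prod pair_measureI)
  have "emeasure lebesgue (dyadic_rect R) = ennreal (1 / 2 ^ (k + l))"
    using b em by simp
  then show "dyadic_rect R \<in> lmeasurable" "measure lebesgue (dyadic_rect R) = 1 / 2 ^ (fst (fst R) + fst (snd R))"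
    using b by (auto simp: fmeasurable_def measure_def R)
qed

lemma sum_measure_disjoint_rects_le:
  assumes "finite T" "disjoint_family_on (\<lambda>t. dyadic_rect (M t)) T"
    and U: "U \<in> lmeasurable" "\<And>t. t \<in> T \<Longrightarrow> dyadic_rect (M t) \<subseteq> U"
  shows "(\<Sum>t\<in>T. measure lebesgue (dyadic_rect (M t))) \<le> measure lebesgue U"
proof -
  have M: "dyadic_rect (M t) \<in> sets lebesgue" "emeasure lebesgue (dyadic_rect (M t)) \<noteq> \<infinity>" for t
    using fmeasurableD[OF measure_dyadic_rect(1)] fmeasurableD2[OF measure_dyadic_rect(1)]
    by (simp_all only: infinity_ennreal_def not_False_eq_True)
  have "(\<Sum>t\<in>T. measure lebesgue (dyadic_rect (M t))) = measure lebesgue (\<Union>t\<in>T. dyadic_rect (M t))"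
    using assms(1,2) M by (intro measure_finite_Union[symmetric]) auto
  also have "\<dots> \<le> measure lebesgue U"
    using assms M by (intro measure_mono_fmeasurable sets.finite_UN) auto
  finally show ?thesis .
qed

lemma dyadic_ivl_nested:
  assumes "l \<le> m" "t \<in> dyadic_ivl (l, i)" "t \<in> dyadic_ivl (m, j)"
  shows "dyadic_ivl (m, j) \<subseteq> dyadic_ivl (l, i)"
proof
  fix u assume "u \<in> dyadic_ivl (m, j)"
  then have "\<lfloor>2 ^ m * u\<rfloor> = \<lfloor>2 ^ m * t\<rfloor>" using assms(3) by (simp add: mem_dyadic_ivl)
  then have "\<lfloor>2 ^ l * u\<rfloor> = \<lfloor>2 ^ l * t\<rfloor>" by (simp only: floor_power2_coarsen[OF assms(1)])
  then show "u \<in> dyadic_ivl (l, i)" using assms(2) by (simp add: mem_dyadic_ivl)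
qed

lemma dyadic_rect_same_level_eq:
  assumes "z \<in> dyadic_rect R" "z \<in> dyadic_rect R'"
    and "fst (fst R) = fst (fst R')" "fst (snd R) = fst (snd R')"
  shows "R = R'"
  using assms by (cases R, cases R') (auto simp: dyadic_rect_def mem_dyadic_ivl)

text \<open>Rectangles of one shape \<open>(k, l)\<close> are pairwise disjoint, so their areas add
  up to at most \<open>|U|\<close>; grouping by shape leaves the sum of the weights.\<close>

lemma sum_weighted_rects_le:
  fixes w :: "nat \<Rightarrow> nat \<Rightarrow> real"
  assumes "finite F" "\<And>R. R \<in> F \<Longrightarrow> dyadic_rect R \<subseteq> U" and U: "U \<in> lmeasurable"
    and w: "\<And>k l. 0 \<le> w k l" "\<And>L. (\<Sum>k<L. \<Sum>l<L. w k l) \<le> W"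
  shows "(\<Sum>R\<in>F. measure lebesgue (dyadic_rect R) * w (fst (fst R)) (fst (snd R))) \<le> W * measure lebesgue U"
proof -
  define lev where "lev R = (fst (fst R), fst (snd R))" for R :: "dyadic \<times> dyadic"
  have "finite (fst ` lev ` F \<union> snd ` lev ` F)" using assms(1) by simp
  then obtain L where L: "\<And>x. x \<in> fst ` lev ` F \<union> snd ` lev ` F \<Longrightarrow> x < L"
    by (meson finite_nat_set_iff_bounded)
  have sub: "lev ` F \<subseteq> {..<L} \<times> {..<L}" using L by (force simp: lev_def)
  have "(\<Sum>R\<in>F. measure lebesgue (dyadic_rect R) * w (fst (fst R)) (fst (snd R)))
      = (\<Sum>p\<in>{..<L} \<times> {..<L}. \<Sum>R | R \<in> F \<and> lev R = p. measure lebesgue (dyadic_rect R) * w (fst (fst R)) (fst (snd R)))"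
    using sub assms(1) by (intro sum.group[symmetric]) auto
  also have "\<dots> = (\<Sum>p\<in>{..<L} \<times> {..<L}. w (fst p) (snd p) * (\<Sum>R | R \<in> F \<and> lev R = p. measure lebesgue (dyadic_rect R)))"
    unfolding sum_distrib_left by (intro sum.cong refl) (auto simp: lev_def mult.commute)
  also have "\<dots> \<le> (\<Sum>p\<in>{..<L} \<times> {..<L}. w (fst p) (snd p) * measure lebesgue U)"
  proof (intro sum_mono mult_left_mono w(1) sum_measure_disjoint_rects_le U)
    fix p
    show "disjoint_family_on dyadic_rect {R \<in> F. lev R = p}"
      unfolding disjoint_family_on_def using dyadic_rect_same_level_eq by (fastforce simp: lev_def)
  qed (use assms in auto)
  also have "\<dots> = (\<Sum>k<L. \<Sum>l<L. w k l) * measure lebesgue U"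
    by (simp add: sum.cartesian_product sum_distrib_right case_prod_beta)
  also have "\<dots> \<le> W * measure lebesgue U"
    by (intro mult_right_mono w(2)) simp
  finally show ?thesis .
qed

text \<open>Each rectangle is charged to the point in it. \<open>H t\<close> is the column of
  rectangles charged to the point \<open>t\<close>, and \<open>M t\<close> is the tallest of them,
  that is, the one of least second level.\<close>

lemma sum_small_rects_le:
  assumes "finite G" and U: "U \<in> lmeasurable" and k: "k \<le> n"
    and G: "\<And>R. R \<in> G \<Longrightarrow> dyadic_rect R \<subseteq> U" "\<And>R. R \<in> G \<Longrightarrow> fst (fst R) = k"
      "\<And>R. R \<in> G \<Longrightarrow> n \<le> k + fst (snd R)"
      "\<And>R. R \<in> G \<Longrightarrow> \<exists>\<tau><2 ^ n. vdc_point n s \<tau> \<in> dyadic_rect R"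
  shows "(\<Sum>R\<in>G. measure lebesgue (dyadic_rect R)) \<le> 2 * measure lebesgue U"
proof -
  obtain \<tau> where \<tau>: "\<And>R. R \<in> G \<Longrightarrow> \<tau> R < 2 ^ n" "\<And>R. R \<in> G \<Longrightarrow> vdc_point n s (\<tau> R) \<in> dyadic_rect R"
    using G(4) by metis
  define H where "H t = {R \<in> G. \<tau> R = t}" for t
  have "\<exists>M. M \<in> H t \<and> (\<forall>R. R \<in> H t \<longrightarrow> fst (snd M) \<le> fst (snd R))" if "t \<in> \<tau> ` G" for t
    using ex_has_least_nat[of "\<lambda>R. R \<in> H t" _ "\<lambda>R. fst (snd R)"] that by (auto simp: H_def)
  then obtain M where M: "\<And>t. t \<in> \<tau> ` G \<Longrightarrow> M t \<in> H t"
      "\<And>t R. t \<in> \<tau> ` G \<Longrightarrow> R \<in> H t \<Longrightarrow> fst (snd (M t)) \<le> fst (snd R)"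
    by metis
  have column: "(\<Sum>R\<in>H t. measure lebesgue (dyadic_rect R)) \<le> 2 * measure lebesgue (dyadic_rect (M t))"
    if t: "t \<in> \<tau> ` G" for t
  proof -
    define m where "m = fst (snd (M t))"
    \<comment> \<open>All rectangles of the column contain one point and have one width, so the
      second level determines the rectangle and the areas are distinct terms of a geometric
      series.\<close>
    have "inj_on (\<lambda>R. fst (snd R)) (H t)"
    proof (rule inj_onI)
      fix R R' assume "R \<in> H t" "R' \<in> H t" "fst (snd R) = fst (snd R')"
      then show "R = R'"
        using \<tau>(2)[of R] \<tau>(2)[of R'] G(2)[of R] G(2)[of R']
        by (intro dyadic_rect_same_level_eq[of "vdc_point n s t"]) (auto simp: H_def)
    qed
    then have inj: "inj_on (\<lambda>R. fst (snd R) - m) (H t)"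
      using M(2)[OF t] unfolding m_def inj_on_def by (metis le_add_diff_inverse)
    have "(\<Sum>R\<in>H t. measure lebesgue (dyadic_rect R)) = (\<Sum>R\<in>H t. 1 / 2 ^ (k + m) * (1 / 2) ^ (fst (snd R) - m))"
    proof (rule sum.cong[OF refl])
      fix R assume R: "R \<in> H t"
      have "fst (snd R) = m + (fst (snd R) - m)" using M(2)[OF t R] by (simp add: m_def)
      then have "measure lebesgue (dyadic_rect R) = 1 / 2 ^ (k + (m + (fst (snd R) - m)))"
        using G(2) R by (simp add: measure_dyadic_rect H_def)
      then show "measure lebesgue (dyadic_rect R) = 1 / 2 ^ (k + m) * (1 / 2) ^ (fst (snd R) - m)"
        by (simp only: power_add power_one_over) simp
    qed
    also have "\<dots> \<le> 1 / 2 ^ (k + m) * (1 / (1 - 1 / 2))"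
      unfolding sum_distrib_left[symmetric]
      using inj \<open>finite G\<close> by (intro mult_left_mono sum_power_le_geometric) (auto simp: H_def)
    also have "\<dots> = 2 * measure lebesgue (dyadic_rect (M t))"
      using M(1)[OF t] G(2) by (simp add: measure_dyadic_rect m_def H_def)
    finally show ?thesis .
  qed
  have disj: "disjoint_family_on (\<lambda>t. dyadic_rect (M t)) (\<tau> ` G)"
  proof -
    have key: "t = t'"
      if t: "t \<in> \<tau> ` G" "t' \<in> \<tau> ` G" and z: "z \<in> dyadic_rect (M t)" "z \<in> dyadic_rect (M t')"
        and le: "fst (snd (M t)) \<le> fst (snd (M t'))" for t t' z
    proof -
      obtain l i j where Mt: "M t = ((k, i), (l, j))"
        using M(1)[OF t(1)] G(2) by (metis (no_types, lifting) H_def mem_Collect_eq prod.collapse)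
      obtain l' i' j' where Mt': "M t' = ((k, i'), (l', j'))"
        using M(1)[OF t(2)] G(2) by (metis (no_types, lifting) H_def mem_Collect_eq prod.collapse)
      have p: "M t \<in> G" "M t' \<in> G" "\<tau> (M t) = t" "\<tau> (M t') = t'"
        using M(1)[OF t(1)] M(1)[OF t(2)] by (auto simp: H_def)
      \<comment> \<open>Equal widths make two meeting rectangles nested, so the taller one holds
        both points, which must then coincide.\<close>
      have "dyadic_rect (M t') \<subseteq> dyadic_rect (M t)"
        using z le dyadic_ivl_nested[of k k "fst z" i i'] dyadic_ivl_nested[of l l' "snd z" j j']
        by (auto simp: dyadic_rect_def Mt Mt')
      then have "vdc_point n s t' \<in> dyadic_rect (M t)" using \<tau>(2)[OF p(2)] p(4) by auto
      moreover have "vdc_point n s t \<in> dyadic_rect (M t)" using \<tau>(2)[OF p(1)] p(3) by simp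
      ultimately show ?thesis
        using \<tau>(1)[OF p(1)] \<tau>(1)[OF p(2)] p(3,4) G(3)[OF p(1)] k
        by (intro vdc_point_unique[of n k l t t' s i j]) (auto simp: Mt)
    qed
    show ?thesis
      unfolding disjoint_family_on_def using key by (metis disjoint_iff nle_le)
  qed
  have "(\<Sum>R\<in>G. measure lebesgue (dyadic_rect R)) = (\<Sum>t\<in>\<tau> ` G. \<Sum>R\<in>H t. measure lebesgue (dyadic_rect R))"
    unfolding H_def using \<open>finite G\<close> by (rule sum.image_gen)
  also have "\<dots> \<le> (\<Sum>t\<in>\<tau> ` G. 2 * measure lebesgue (dyadic_rect (M t)))"
    by (intro sum_mono column)
  also have "\<dots> \<le> 2 * measure lebesgue U"
    unfolding sum_distrib_left[symmetric]
    using disj U \<open>finite G\<close> M(1) G(1) by (intro mult_left_mono sum_measure_disjoint_rects_le) (auto simp: H_def)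
  finally show ?thesis .
qed

text \<open>For large \<open>R\<close> the bound \<open>1 / N\<close> gives
  \<open>(1 / N)\<^sup>2 / |R| = |R| / (N |R|)\<^sup>2\<close>, which is area times weight. For
  small \<open>R\<close> the linear part contributes at most \<open>|R| (N |R|)\<^sup>2\<close>,
  again area times weight, and the tent part goes into the second summand.\<close>

lemma haar_coefficient_bound:
  fixes R :: "dyadic \<times> dyadic" and n :: nat and \<sigma> :: real
  assumes R: "R \<in> dyadic_rects"
  defines "s \<equiv> \<lambda>i. bin_digit (n - i) \<sigma> = 1"
  shows "(inner_L2 (discrepancy (vdc_set n \<sigma>)) (haar_rect R))\<^sup>2 / measure lebesgue (dyadic_rect R)
    \<le> measure lebesgue (dyadic_rect R) * level_weight n (fst (fst R)) (fst (snd R))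
      + (if fst (fst R) \<le> n \<and> n \<le> fst (fst R) + fst (snd R) \<and> (\<exists>\<tau><2 ^ n. vdc_point n s \<tau> \<in> dyadic_rect R)
         then measure lebesgue (dyadic_rect R) else 0)"
proof -
  obtain k i l j where R_eq: "R = ((k, i), (l, j))" by (metis surj_pair)
  have ij: "(k, i) \<in> dyadics" "(l, j) \<in> dyadics" "i < 2 ^ k" "j < 2 ^ l"
    using R by (auto simp: dyadic_rects_def dyadics_def R_eq)
  define q where "q = (2::real) ^ (k + l)"
  define N where "N = (2::real) ^ n"
  have q: "q > 0" and N: "N > 0" by (simp_all add: q_def N_def)
  have four: "(4::real) ^ m = (2 ^ m)\<^sup>2" for m by (simp add: power2_eq_square flip: power_mult_distrib)
  define t where "t = tent_sum n s R"
  have c: "inner_L2 (discrepancy (vdc_set n \<sigma>)) (haar_rect R) = t - N / (16 * q\<^sup>2)"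
    unfolding R_eq t_def by (simp add: inner_L2_discrepancy[OF ij(1,2)] s_def N_def q_def four)
  have mR: "measure lebesgue (dyadic_rect R) = 1 / q"
    by (simp add: measure_dyadic_rect R_eq q_def)
  show ?thesis
  proof (cases "k + l \<le> n")
    case True
    have w: "level_weight n k l = q\<^sup>2 / N\<^sup>2"
      using True by (simp add: level_weight_def power_one_over power_diff power_divide four q_def N_def)
    have "\<bar>t - N / (16 * q\<^sup>2)\<bar> \<le> 1 / N"
      using tent_sum_approx[OF True ij(3,4), of s] by (simp add: t_def R_eq N_def q_def four)
    then have "(t - N / (16 * q\<^sup>2))\<^sup>2 \<le> (1 / N)\<^sup>2"
      by (metis abs_ge_zero power2_abs power_mono)
    then have "(t - N / (16 * q\<^sup>2))\<^sup>2 * q \<le> (1 / N)\<^sup>2 * q"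
      using q by (intro mult_right_mono) auto
    also have "\<dots> = 1 / q * level_weight n k l"
      using q by (simp add: w power2_eq_square)
    finally have "(t - N / (16 * q\<^sup>2))\<^sup>2 * q \<le> 1 / q * level_weight n k l" .
    then show ?thesis
      unfolding c mR using q by (simp add: R_eq add_increasing2)
  next
    case False
    have w: "level_weight n k l = N\<^sup>2 / q\<^sup>2"
      using False by (simp add: level_weight_def power_one_over power_diff power_divide four q_def N_def)
    have t0: "0 \<le> t" by (simp add: t_def tent_sum_nonneg)
    have "(t - N / (16 * q\<^sup>2))\<^sup>2 \<le> t\<^sup>2 + (N / (16 * q\<^sup>2))\<^sup>2"
      using t0 q N by (simp add: power2_diff)
    then have "(t - N / (16 * q\<^sup>2))\<^sup>2 * q \<le> (t\<^sup>2 + (N / (16 * q\<^sup>2))\<^sup>2) * q"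
      using q by (intro mult_right_mono) auto
    moreover have "(N / (16 * q\<^sup>2))\<^sup>2 * q \<le> 1 / q * level_weight n k l"
    proof -
      have "q \<ge> 1" by (simp add: q_def)
      \<comment> \<open>\<open>256\<close> is the square of the \<open>16\<close> in the linear
        part.\<close>
      then have "N\<^sup>2 * 1 \<le> N\<^sup>2 * 256" by (intro mult_left_mono) auto
      then show ?thesis using q by (simp add: w power2_eq_square field_simps)
    qed
    moreover have "t\<^sup>2 * q \<le> (if k \<le> n \<and> n \<le> k + l \<and> (\<exists>\<tau><2 ^ n. vdc_point n s \<tau> \<in> dyadic_rect R) then 1 / q else 0)"
    proof (cases "k \<le> n \<and> (\<exists>\<tau><2 ^ n. vdc_point n s \<tau> \<in> dyadic_rect R)")
      case True
      have "card {\<tau>. \<tau> < 2 ^ n \<and> vdc_point n s \<tau> \<in> dyadic_rect R} \<le> 1"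
        using vdc_point_unique[of n k l _ _ s i j] True False
        by (auto simp: card_le_Suc0_iff_eq R_eq)
      then have "t \<le> 1 / (4 * q)"
        using tent_sum_le_card[of n s k i l j] q
        by (auto simp: t_def R_eq q_def intro!: divide_right_mono intro: order_trans)
      also have "\<dots> \<le> 1 / q" using q by (simp add: field_simps)
      finally have "t\<^sup>2 \<le> (1 / q)\<^sup>2" using t0 by (intro power_mono)
      then have "t\<^sup>2 * q \<le> (1 / q)\<^sup>2 * q" using q by (intro mult_right_mono) auto
      then show ?thesis using True False q by (simp add: power2_eq_square)
    next
      case no: False
      \<comment> \<open>Either no point lies in \<open>R\<close>, or \<open>k > n\<close> and the
        tents of the first side vanish at all cell centres. This confines the tent parts to
        \<open>n + 1\<close> widths.\<close>
      have "t = 0"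
      proof (cases "k \<le> n")
        case True
        then have "{\<tau>. \<tau> < 2 ^ n \<and> vdc_point n s \<tau> \<in> dyadic_rect R} = {}" using no by auto
        then show ?thesis unfolding t_def tent_sum_restrict by (simp only: sum.empty)
      next
        case False
        then show ?thesis by (simp add: t_def tent_sum_def R_eq vdc_point_def tent_cell_mid_eq_0)
      qed
      then show ?thesis using no by auto
    qed
    ultimately have "(t - N / (16 * q\<^sup>2))\<^sup>2 * q \<le> 1 / q * level_weight n k l
      + (if k \<le> n \<and> n \<le> k + l \<and> (\<exists>\<tau><2 ^ n. vdc_point n s \<tau> \<in> dyadic_rect R) then 1 / q else 0)"
      by (simp add: distrib_right)
    then show ?thesis unfolding c mR by (simp add: R_eq)
  qed
qed

section \<open>The sum over all rectangles in \<open>U\<close> and the norm\<close>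

lemma sum_haar_coefficients_le:
  assumes "n \<ge> 1" and U: "U \<in> lmeasurable"
    and F: "finite F" "F \<subseteq> {R \<in> dyadic_rects. dyadic_rect R \<subseteq> U}"
  shows "(\<Sum>R\<in>F. (inner_L2 (discrepancy (vdc_set n \<sigma>)) (haar_rect R))\<^sup>2 / measure lebesgue (dyadic_rect R))
    \<le> 14 * real n * measure lebesgue U"
proof -
  define s where "s = (\<lambda>i. bin_digit (n - i) \<sigma> = 1)"
  define G where "G = {R \<in> F. fst (fst R) \<le> n \<and> n \<le> fst (fst R) + fst (snd R) \<and> (\<exists>\<tau><2 ^ n. vdc_point n s \<tau> \<in> dyadic_rect R)}"
  have "(\<Sum>R\<in>F. (inner_L2 (discrepancy (vdc_set n \<sigma>)) (haar_rect R))\<^sup>2 / measure lebesgue (dyadic_rect R))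
      \<le> (\<Sum>R\<in>F. measure lebesgue (dyadic_rect R) * level_weight n (fst (fst R)) (fst (snd R))
          + (if R \<in> G then measure lebesgue (dyadic_rect R) else 0))"
  proof (rule sum_mono)
    fix R assume "R \<in> F"
    then have "R \<in> dyadic_rects" using F(2) by auto
    from haar_coefficient_bound[OF this, of n \<sigma>] \<open>R \<in> F\<close>
    show "(inner_L2 (discrepancy (vdc_set n \<sigma>)) (haar_rect R))\<^sup>2 / measure lebesgue (dyadic_rect R)
        \<le> measure lebesgue (dyadic_rect R) * level_weight n (fst (fst R)) (fst (snd R))
          + (if R \<in> G then measure lebesgue (dyadic_rect R) else 0)"
      by (simp add: G_def s_def)
  qed
  also have "\<dots> = (\<Sum>R\<in>F. measure lebesgue (dyadic_rect R) * level_weight n (fst (fst R)) (fst (snd R)))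
      + (\<Sum>R\<in>G. measure lebesgue (dyadic_rect R))"
    using F(1) by (simp add: sum.distrib sum.inter_filter[symmetric]) (auto simp: G_def intro: sum.cong)
  also have "(\<Sum>R\<in>F. measure lebesgue (dyadic_rect R) * level_weight n (fst (fst R)) (fst (snd R)))
      \<le> (3 * real n + 7) * measure lebesgue U"
    using F U by (intro sum_weighted_rects_le level_weight_nonneg sum_level_weight_le) auto
  \<comment> \<open>Grouping by width: \<open>sum_small_rects_le\<close> handles one width at a
    time.\<close>
  also have "(\<Sum>R\<in>G. measure lebesgue (dyadic_rect R))
      = (\<Sum>k\<le>n. \<Sum>R | R \<in> G \<and> fst (fst R) = k. measure lebesgue (dyadic_rect R))"
    using F(1) by (intro sum.group[symmetric]) (auto simp: G_def)
  also have "\<dots> \<le> (\<Sum>k\<le>n. 2 * measure lebesgue U)"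
  proof (rule sum_mono)
    fix k assume "k \<in> {..n}"
    then show "(\<Sum>R | R \<in> G \<and> fst (fst R) = k. measure lebesgue (dyadic_rect R)) \<le> 2 * measure lebesgue U"
      using F U by (intro sum_small_rects_le[of _ U k n s]) (auto simp: G_def)
  qed
  also have "(3 * real n + 7) * measure lebesgue U + (\<Sum>k\<le>n. 2 * measure lebesgue U) = (5 * real n + 9) * measure lebesgue U"
    by (simp add: algebra_simps)
  \<comment> \<open>\<open>5 n + 9 <= 14 n\<close> because \<open>n >= 1\<close>.\<close>
  also have "\<dots> \<le> 14 * real n * measure lebesgue U"
    using assms(1) by (intro mult_right_mono) auto
  finally show ?thesis by simp
qed

lemma ennsqrt_le:
  assumes "x \<le> ennreal c" "0 \<le> c"
  shows "ennsqrt x \<le> ennreal (sqrt c)"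
proof -
  have fin: "x \<noteq> \<infinity>" using assms(1) by (auto simp: top_unique)
  then have "enn2real x \<le> c" using assms by (simp add: enn2real_leI)
  then show ?thesis using fin by (simp add: ennsqrt_def ennreal_leI)
qed

theorem theorem1p5:
  shows "\<exists>C::real. C > 0 \<and>
    (\<forall>n\<ge>1. \<forall>\<sigma>\<in>{0..<1::real}. \<forall>N::nat. N = 2 ^ n \<longrightarrow>
       bmo_norm (discrepancy (vdc_set n \<sigma>)) \<le> ennreal (C * sqrt (ln (real N))))"
proof (intro exI[of _ "6::real"] conjI allI impI ballI)
  fix n N :: nat and \<sigma> :: real
  assume n: "1 \<le> n" and N: "N = 2 ^ n"
  \<comment> \<open>The constant \<open>6\<close> comes from
    \<open>14 n <= 36 n ln 2 = 36 ln N\<close>.\<close>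
  have "14 \<le> 36 * ln (2::real)" using ln2_ge_two_thirds by simp
  then have "14 * real n \<le> 36 * ln 2 * real n" by (intro mult_right_mono) auto
  then have "sqrt (14 * real n) \<le> sqrt (36 * (real n * ln 2))"
    by (intro real_sqrt_le_mono) (simp add: mult_ac)
  also have "\<dots> = 6 * sqrt (ln (real N))"
    by (simp add: N ln_realpow real_sqrt_mult)
  finally have C: "sqrt (14 * real n) \<le> 6 * sqrt (ln (real N))" .
  show "bmo_norm (discrepancy (vdc_set n \<sigma>)) \<le> ennreal (6 * sqrt (ln (real N)))"
    unfolding bmo_norm_def
  proof (rule SUP_least)
    fix U :: "(real \<times> real) set"
    assume "U \<in> {U \<in> sets lebesgue. U \<subseteq> unit_square \<and> measure lebesgue U > 0}"
    then have U: "U \<in> sets lebesgue" "U \<subseteq> unit_square" "measure lebesgue U > 0" by auto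
    \<comment> \<open>Boundedness gives \<open>U\<close> finite measure, so the division by its
      \<open>emeasure\<close> below is a division of reals.\<close>
    have "bounded unit_square" by (intro bounded_Times bounded_closed_interval)
    then have lm: "U \<in> lmeasurable"
      using U bounded_subset by (intro bounded_set_imp_lmeasurable) auto
    then have eU: "emeasure lebesgue U = ennreal (measure lebesgue U)"
      by (simp add: emeasure_eq_measure2)
    define c where "c R = (inner_L2 (discrepancy (vdc_set n \<sigma>)) (haar_rect R))\<^sup>2 / measure lebesgue (dyadic_rect R)" for R
    have c0: "0 \<le> c R" for R by (simp add: c_def)
    have "(\<Sum>\<^sub>\<infinity>R \<in> {R \<in> dyadic_rects. dyadic_rect R \<subseteq> U}. ennreal (c R)) \<le> ennreal (14 * real n * measure lebesgue U)"
    \<comment> \<open>In the extended nonnegative reals a bound on all finite partial sums bounds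
      the infinite sum.\<close>
    proof (rule infsum_le_finite_sums)
      fix F assume F: "finite F" "F \<subseteq> {R \<in> dyadic_rects. dyadic_rect R \<subseteq> U}"
      have "(\<Sum>R\<in>F. ennreal (c R)) = ennreal (\<Sum>R\<in>F. c R)" by (simp add: c0)
      also have "\<dots> \<le> ennreal (14 * real n * measure lebesgue U)"
        unfolding c_def by (intro ennreal_leI sum_haar_coefficients_le n lm F)
      finally show "(\<Sum>R\<in>F. ennreal (c R)) \<le> ennreal (14 * real n * measure lebesgue U)" .
    qed (rule nonneg_summable_on_complete, simp)
    then have "(\<Sum>\<^sub>\<infinity>R \<in> {R \<in> dyadic_rects. dyadic_rect R \<subseteq> U}. ennreal (c R)) / emeasure lebesgue U
        \<le> ennreal (14 * real n * measure lebesgue U) / ennreal (measure lebesgue U)"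
      unfolding eU by (rule divide_right_mono_ennreal)
    also have "\<dots> = ennreal (14 * real n)"
      using U(3) by (simp add: divide_ennreal)
    finally have "ennsqrt ((\<Sum>\<^sub>\<infinity>R \<in> {R \<in> dyadic_rects. dyadic_rect R \<subseteq> U}. ennreal (c R)) / emeasure lebesgue U)
        \<le> ennreal (sqrt (14 * real n))"
      by (intro ennsqrt_le) auto
    also have "\<dots> \<le> ennreal (6 * sqrt (ln (real N)))"
      by (rule ennreal_leI[OF C])
    finally show "ennsqrt ((\<Sum>\<^sub>\<infinity>R \<in> {R \<in> dyadic_rects. dyadic_rect R \<subseteq> U}.
        ennreal ((inner_L2 (discrepancy (vdc_set n \<sigma>)) (haar_rect R))\<^sup>2 / measure lebesgue (dyadic_rect R)))
        / emeasure lebesgue U) \<le> ennreal (6 * sqrt (ln (real N)))"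
      unfolding c_def .
  qed
qed simp

end
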